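(* Let $\mathcal{C}$ be an abelian category and let $E,F$ be allowable classes in $\mathcal{C}$ with $F\subseteq E$. Suppose that $F$ has retractile monics; $E$ has retractile monics and sectile epics; $\mathcal{C}$ has enough $F$-injectives; $\mathcal{C}$ has enough $E$-projectives and enough $E$-injectives; and every $E$-projective object is $E$-injective. Let $\mathcal{C}_{E-we}^{F-cof}$ denote the Waldhausen category with underlying category $\mathcal{C}$, with cofibrations the $F$-monomorphisms and weak equivalences the $E$-stable equivalences. Then $\mathcal{C}_{E-we}^{F-cof}$ admits a cylinder functor satisfying the cylinder axiom if and only if $\mathcal{C}$ is functorially cone-Frobenius relative to $E,F$.
   Context: **Relative homological algebra.** An allowable class $E$ in an abelian category $\mathcal{C}$ is a collection of short exact sequences in $\mathcal{C}$, closed under isomorphism of short exact sequences and containing every short exact sequence in which at least one object is zero. A monomorphism $f:M\to N$ is an $E$-monomorphism (or $E$-monic) if $0\to M\xrightarrow{f} N\to \operatorname{coker} f\to 0$ is in $E$. An epimorphism $f: M\to N$ is an $E$-epimorphism (or $E$-epic) if $0\to\ker f\to M\xrightarrow{f} N\to 0$ is in $E$. An object $X$ is $E$-projective if for every $E$-epic $f:M\to N$, every map $X\to N$ lifts through $f$ to a map $X\to M$; $X$ is $E$-injective if for every $E$-monic $f:M\to N$, every map $M\to X$ extends along $f$ to a map $N\to X$. $\mathcal{C}$ has enough $E$-projectives if every object $M$ admits an $E$-epic $N\to M$ with $N$ $E$-projective; it has enough $E$-injectives if every object $M$ admits an $E$-monic $M\to N$ with $N$ $E$-injective. $E$ has retractile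 monics if whenever $g\circ f$ is an $E$-monic, $f$ is an $E$-monic; $E$ has sectile epics if whenever $g\circ f$ is an $E$-epic, $g$ is an $E$-epic. Maps $f,g:M\to N$ are $E$-stably equivalent, written $f\simeq g$, if $f-g$ factors through an $E$-projective object. A map $f:M\to N$ is an $E$-stable equivalence if there is $h:N\to M$ with $f\circ h\simeq \mathrm{id}_N$ and $h\circ f\simeq\mathrm{id}_M$. **Cone-Frobenius condition.** $\mathcal{C}$ is functorially cone-Frobenius relative to $E,F$ if there exist a functor $J:\mathcal{C}\to\mathcal{C}$ and a natural transformation $\eta:\mathrm{id}_{\mathcal{C}}\to J$ such that: (1) $J(X)$ is $E$-projective for every object $X$; (2) $\eta(X):X\to J(X)$ is an $F$-monomorphism for every object $X$; (3) if $f:X\to Y$ is an $F$-monomorphism then so is $J(f):J(X)\to J(Y)$, and so is the universal map $Y\coprod_X J(X)\to J(Y)$. **Waldhausen categories.** A Waldhausen category is a pointed category (zero object $\mathrm{pt}$) with finite pushouts, with a specified class of cofibrations and a specified class of weak equivalences, both closed under composition, such that: (Cof 1) isomorphisms are cofibrations; (Cof 2) $\mathrm{pt}\to X$ is a cofibration for every object $X$; (Cof 3) if $X\to Y$ is a morphism and $X\to Z$ a cofibration, then $Y\to Y\coprod_X Z$ is a cofibration; (Weq 1) isomorphisms are weak equivalences; (Weq 2) given a commutative diagram with rows $Y\leftarrow X\to Z$ and $Y'\leftarrow X'\to Z'$ and vertical maps from the first row to the second, with $X\to Y$ and $X'\to Y'$ cofibrations and all three vertical maps weak equivalences, the induced map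 $Y\coprod_X Z\to Y'\coprod_{X'}Z'$ is a weak equivalence. Under the hypotheses of the claim, $\mathcal{C}_{E-we}^{F-cof}$ is a Waldhausen category. **Cylinder functors.** A cylinder functor on a Waldhausen category is a functor from the category of arrows $f:X\to Y$ to the category of diagrams consisting of an object $T(f)$ and maps $j_1:X\to T(f)$, $j_2:Y\to T(f)$, $p:T(f)\to Y$ with $p\circ j_1=f$ and $p\circ j_2=\mathrm{id}_Y$, such that: (Cyl 1) given a commutative square from $f':X'\to Y'$ to $f:X\to Y$ whose vertical maps $X'\to X$, $Y'\to Y$ are weak equivalences, the map $T(f')\to T(f)$ is a weak equivalence; and if the vertical maps are cofibrations, then $T(f')\to T(f)$ and $X\coprod_{X'}T(f')\coprod_{Y'}Y\to T(f)$ are cofibrations; (Cyl 2) $T(\mathrm{pt}\to Y)=Y$, with $p$ and $j_2$ the identity of $Y$; (Cyl 3) $j_1\coprod j_2:X\coprod Y\to T(f)$ is a cofibration. It satisfies the cylinder axiom if for every map $f$ the map $p$ is a weak equivalence. *)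

theory Defs
  imports "HOL-Algebra.Group"
begin

section \<open>Categories, functors, natural transformations\<close>

text \<open>A small category, given by carriers of objects and arrows. Every arrow has one domain and one
  codomain; \<open>g \<cdot> f\<close> is ``first \<open>f\<close>, then \<open>g\<close>'' and is meaningful only if \<open>Cod f = Dom g\<close>.\<close>

record ('o, 'm) cat =
  Obj :: "'o set"
  Arr :: "'m set"
  Dom :: "'m \<Rightarrow> 'o"
  Cod :: "'m \<Rightarrow> 'o"
  Ident :: "'o \<Rightarrow> 'm"
  Comp :: "'m \<Rightarrow> 'm \<Rightarrow> 'm"  (infixr "\<cdot>\<index>" 70)

definition Hom :: "('o, 'm, 'z) cat_scheme \<Rightarrow> 'o \<Rightarrow> 'o \<Rightarrow> 'm set"
  where "Hom C X Y = {f \<in> Arr C. Dom C f = X \<and> Cod C f = Y}"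

locale category =
  fixes C :: "('o, 'm, 'z) cat_scheme" (structure)
  assumes dom_obj: "f \<in> Arr C \<Longrightarrow> Dom C f \<in> Obj C"
    and cod_obj: "f \<in> Arr C \<Longrightarrow> Cod C f \<in> Obj C"
    and ident_hom: "X \<in> Obj C \<Longrightarrow> Ident C X \<in> Hom C X X"
    and comp_hom: "f \<in> Hom C X Y \<Longrightarrow> g \<in> Hom C Y Z \<Longrightarrow> g \<cdot> f \<in> Hom C X Z"
    and ident_right: "f \<in> Hom C X Y \<Longrightarrow> f \<cdot> Ident C X = f"
    and ident_left: "f \<in> Hom C X Y \<Longrightarrow> Ident C Y \<cdot> f = f"
    and comp_assoc: "f \<in> Hom C W X \<Longrightarrow> g \<in> Hom C X Y \<Longrightarrow> h \<in> Hom C Y Z \<Longrightarrow>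
      h \<cdot> (g \<cdot> f) = (h \<cdot> g) \<cdot> f"

definition is_functor ::
  "('o, 'm, 'z) cat_scheme \<Rightarrow> ('p, 'n, 'y) cat_scheme \<Rightarrow> ('o \<Rightarrow> 'p) \<Rightarrow> ('m \<Rightarrow> 'n) \<Rightarrow> bool"
  where "is_functor A B FO FM \<longleftrightarrow> category A \<and> category B \<and>
    (\<forall>X \<in> Obj A. FO X \<in> Obj B) \<and>
    (\<forall>f \<in> Arr A. FM f \<in> Hom B (FO (Dom A f)) (FO (Cod A f))) \<and>
    (\<forall>X \<in> Obj A. FM (Ident A X) = Ident B (FO X)) \<and>
    (\<forall>f \<in> Arr A. \<forall>g \<in> Arr A. Cod A f = Dom A g \<longrightarrow> FM (g \<cdot>\<^bsub>A\<^esub> f) = FM g \<cdot>\<^bsub>B\<^esub> FM f)"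

definition is_nat_trans ::
  "('o, 'm, 'z) cat_scheme \<Rightarrow> ('p, 'n, 'y) cat_scheme \<Rightarrow>
   ('o \<Rightarrow> 'p) \<Rightarrow> ('m \<Rightarrow> 'n) \<Rightarrow> ('o \<Rightarrow> 'p) \<Rightarrow> ('m \<Rightarrow> 'n) \<Rightarrow> ('o \<Rightarrow> 'n) \<Rightarrow> bool"
  where "is_nat_trans A B FO FM GO GM \<eta> \<longleftrightarrow> is_functor A B FO FM \<and> is_functor A B GO GM \<and>
    (\<forall>X \<in> Obj A. \<eta> X \<in> Hom B (FO X) (GO X)) \<and>
    (\<forall>f \<in> Arr A. \<eta> (Cod A f) \<cdot>\<^bsub>B\<^esub> FM f = GM f \<cdot>\<^bsub>B\<^esub> \<eta> (Dom A f))"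

text \<open>An arrow from \<open>f'\<close> to \<open>f\<close> in the arrow category is a commutative square
  \<open>f \<cdot> x = y \<cdot> f'\<close>, encoded as \<open>(f', (x, y), f)\<close>.\<close>

definition arrow_category ::
  "('o, 'm, 'z) cat_scheme \<Rightarrow> ('m, 'm \<times> ('m \<times> 'm) \<times> 'm) cat"
  where "arrow_category C = \<lparr>
    Obj = Arr C,
    Arr = {(f', (x, y), f) | f' x y f. f' \<in> Arr C \<and> f \<in> Arr C \<and>
      x \<in> Hom C (Dom C f') (Dom C f) \<and> y \<in> Hom C (Cod C f') (Cod C f) \<and>
      f \<cdot>\<^bsub>C\<^esub> x = y \<cdot>\<^bsub>C\<^esub> f'},
    Dom = (\<lambda>(f', (x, y), f). f'),
    Cod = (\<lambda>(f', (x, y), f). f),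
    Ident = (\<lambda>f. (f, (Ident C (Dom C f), Ident C (Cod C f)), f)),
    Comp = (\<lambda>(_, (x2, y2), f2) (f0, (x1, y1), _). (f0, (x2 \<cdot>\<^bsub>C\<^esub> x1, y2 \<cdot>\<^bsub>C\<^esub> y1), f2))\<rparr>"

definition monic :: "('o, 'm, 'z) cat_scheme \<Rightarrow> 'm \<Rightarrow> bool"
  where "monic C f \<longleftrightarrow> f \<in> Arr C \<and>
    (\<forall>a \<in> Arr C. \<forall>b \<in> Arr C. Dom C a = Dom C b \<and> Cod C a = Dom C f \<and> Cod C b = Dom C f \<and>
      f \<cdot>\<^bsub>C\<^esub> a = f \<cdot>\<^bsub>C\<^esub> b \<longrightarrow> a = b)"

definition epic :: "('o, 'm, 'z) cat_scheme \<Rightarrow> 'm \<Rightarrow> bool"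
  where "epic C f \<longleftrightarrow> f \<in> Arr C \<and>
    (\<forall>a \<in> Arr C. \<forall>b \<in> Arr C. Cod C a = Cod C b \<and> Dom C a = Cod C f \<and> Dom C b = Cod C f \<and>
      a \<cdot>\<^bsub>C\<^esub> f = b \<cdot>\<^bsub>C\<^esub> f \<longrightarrow> a = b)"

definition isomorphism :: "('o, 'm, 'z) cat_scheme \<Rightarrow> 'm \<Rightarrow> bool"
  where "isomorphism C f \<longleftrightarrow> f \<in> Arr C \<and>
    (\<exists>g \<in> Hom C (Cod C f) (Dom C f).
      g \<cdot>\<^bsub>C\<^esub> f = Ident C (Dom C f) \<and> f \<cdot>\<^bsub>C\<^esub> g = Ident C (Cod C f))"

definition zero_object :: "('o, 'm, 'z) cat_scheme \<Rightarrow> 'o \<Rightarrow> bool"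
  where "zero_object C Z \<longleftrightarrow> Z \<in> Obj C \<and>
    (\<forall>X \<in> Obj C. (\<exists>!f. f \<in> Hom C Z X) \<and> (\<exists>!f. f \<in> Hom C X Z))"

text \<open>\<open>i1 : X \<rightarrow> P \<leftarrow> Y : i2\<close> is a coproduct of \<open>X\<close> and \<open>Y\<close>.\<close>

definition is_coproduct :: "('o, 'm, 'z) cat_scheme \<Rightarrow> 'o \<Rightarrow> 'o \<Rightarrow> 'm \<Rightarrow> 'm \<Rightarrow> bool"
  where "is_coproduct C X Y i1 i2 \<longleftrightarrow> i1 \<in> Arr C \<and> i2 \<in> Arr C \<and>
    Dom C i1 = X \<and> Dom C i2 = Y \<and> Cod C i1 = Cod C i2 \<and>
    (\<forall>W \<in> Obj C. \<forall>a \<in> Hom C X W. \<forall>b \<in> Hom C Y W.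
      \<exists>!u. u \<in> Hom C (Cod C i1) W \<and> u \<cdot>\<^bsub>C\<^esub> i1 = a \<and> u \<cdot>\<^bsub>C\<^esub> i2 = b)"

text \<open>For a span \<open>f : X \<rightarrow> Y\<close>, \<open>g : X \<rightarrow> Z\<close>: the cospan \<open>i : Y \<rightarrow> P\<close>, \<open>j : Z \<rightarrow> P\<close> is a pushout of it.\<close>

definition is_pushout :: "('o, 'm, 'z) cat_scheme \<Rightarrow> 'm \<Rightarrow> 'm \<Rightarrow> 'm \<Rightarrow> 'm \<Rightarrow> bool"
  where "is_pushout C f g i j \<longleftrightarrow>
    f \<in> Arr C \<and> g \<in> Arr C \<and> i \<in> Arr C \<and> j \<in> Arr C \<and>
    Dom C f = Dom C g \<and> Dom C i = Cod C f \<and> Dom C j = Cod C g \<and> Cod C i = Cod C j \<and>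
    i \<cdot>\<^bsub>C\<^esub> f = j \<cdot>\<^bsub>C\<^esub> g \<and>
    (\<forall>W \<in> Obj C. \<forall>a \<in> Hom C (Cod C f) W. \<forall>b \<in> Hom C (Cod C g) W.
      a \<cdot>\<^bsub>C\<^esub> f = b \<cdot>\<^bsub>C\<^esub> g \<longrightarrow>
      (\<exists>!u. u \<in> Hom C (Cod C i) W \<and> u \<cdot>\<^bsub>C\<^esub> i = a \<and> u \<cdot>\<^bsub>C\<^esub> j = b))"


section \<open>Preadditive and abelian categories\<close>

record ('o, 'm) acat = "('o, 'm) cat" +
  Add :: "'m \<Rightarrow> 'm \<Rightarrow> 'm"
  Zero :: "'o \<Rightarrow> 'o \<Rightarrow> 'm"

definition hom_group :: "('o, 'm, 'z) acat_scheme \<Rightarrow> 'o \<Rightarrow> 'o \<Rightarrow> 'm monoid"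
  where "hom_group C X Y = \<lparr>carrier = Hom C X Y, mult = Add C, one = Zero C X Y\<rparr>"

definition hom_diff :: "('o, 'm, 'z) acat_scheme \<Rightarrow> 'o \<Rightarrow> 'o \<Rightarrow> 'm \<Rightarrow> 'm \<Rightarrow> 'm"
  where "hom_diff C X Y f g = Add C f (inv\<^bsub>hom_group C X Y\<^esub> g)"

definition is_kernel :: "('o, 'm, 'z) acat_scheme \<Rightarrow> 'm \<Rightarrow> 'm \<Rightarrow> bool"
  where "is_kernel C k f \<longleftrightarrow> k \<in> Arr C \<and> f \<in> Arr C \<and> Cod C k = Dom C f \<and>
    f \<cdot>\<^bsub>C\<^esub> k = Zero C (Dom C k) (Cod C f) \<and>
    (\<forall>h \<in> Arr C. Cod C h = Dom C f \<and> f \<cdot>\<^bsub>C\<^esub> h = Zero C (Dom C h) (Cod C f) \<longrightarrow>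
      (\<exists>!u. u \<in> Hom C (Dom C h) (Dom C k) \<and> k \<cdot>\<^bsub>C\<^esub> u = h))"

definition is_cokernel :: "('o, 'm, 'z) acat_scheme \<Rightarrow> 'm \<Rightarrow> 'm \<Rightarrow> bool"
  where "is_cokernel C c f \<longleftrightarrow> c \<in> Arr C \<and> f \<in> Arr C \<and> Dom C c = Cod C f \<and>
    c \<cdot>\<^bsub>C\<^esub> f = Zero C (Dom C f) (Cod C c) \<and>
    (\<forall>h \<in> Arr C. Dom C h = Cod C f \<and> h \<cdot>\<^bsub>C\<^esub> f = Zero C (Dom C f) (Cod C h) \<longrightarrow>
      (\<exists>!u. u \<in> Hom C (Cod C c) (Cod C h) \<and> u \<cdot>\<^bsub>C\<^esub> c = h))"

definition is_biproduct ::
  "('o, 'm, 'z) acat_scheme \<Rightarrow> 'o \<Rightarrow> 'o \<Rightarrow> 'o \<Rightarrow> 'm \<Rightarrow> 'm \<Rightarrow> 'm \<Rightarrow> 'm \<Rightarrow> bool"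
  where "is_biproduct C X Y P i1 i2 p1 p2 \<longleftrightarrow> P \<in> Obj C \<and>
    i1 \<in> Hom C X P \<and> i2 \<in> Hom C Y P \<and> p1 \<in> Hom C P X \<and> p2 \<in> Hom C P Y \<and>
    p1 \<cdot>\<^bsub>C\<^esub> i1 = Ident C X \<and> p2 \<cdot>\<^bsub>C\<^esub> i2 = Ident C Y \<and>
    Add C (i1 \<cdot>\<^bsub>C\<^esub> p1) (i2 \<cdot>\<^bsub>C\<^esub> p2) = Ident C P"

locale preadditive_category = category C for C :: "('o, 'm, 'z) acat_scheme" (structure) +
  assumes hom_comm_group: "X \<in> Obj C \<Longrightarrow> Y \<in> Obj C \<Longrightarrow> comm_group (hom_group C X Y)"
    and comp_add_left: "f \<in> Hom C X Y \<Longrightarrow> g \<in> Hom C Y Z \<Longrightarrow> g' \<in> Hom C Y Z \<Longrightarrow>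
      Add C g g' \<cdot> f = Add C (g \<cdot> f) (g' \<cdot> f)"
    and comp_add_right: "f \<in> Hom C X Y \<Longrightarrow> f' \<in> Hom C X Y \<Longrightarrow> g \<in> Hom C Y Z \<Longrightarrow>
      g \<cdot> Add C f f' = Add C (g \<cdot> f) (g \<cdot> f')"

locale abelian_category = preadditive_category +
  assumes ex_zero_object: "\<exists>Z. zero_object C Z"
    and ex_biproduct: "X \<in> Obj C \<Longrightarrow> Y \<in> Obj C \<Longrightarrow>
      \<exists>P i1 i2 p1 p2. is_biproduct C X Y P i1 i2 p1 p2"
    and ex_kernel: "f \<in> Arr C \<Longrightarrow> \<exists>k. is_kernel C k f"
    and ex_cokernel: "f \<in> Arr C \<Longrightarrow> \<exists>c. is_cokernel C c f"
    and monic_is_kernel: "monic C f \<Longrightarrow> \<exists>g. is_kernel C f g"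
    and epic_is_cokernel: "epic C f \<Longrightarrow> \<exists>g. is_cokernel C f g"


section \<open>Relative homological algebra\<close>

text \<open>A short exact sequence \<open>0 \<rightarrow> X \<rightarrow> Y \<rightarrow> Z \<rightarrow> 0\<close> is represented by the pair of its two
  nontrivial arrows \<open>f : X \<rightarrow> Y\<close>, \<open>g : Y \<rightarrow> Z\<close>.\<close>

definition short_exact :: "('o, 'm, 'z) acat_scheme \<Rightarrow> 'm \<Rightarrow> 'm \<Rightarrow> bool"
  where "short_exact C f g \<longleftrightarrow> is_kernel C f g \<and> is_cokernel C g f"

definition ses_iso :: "('o, 'm, 'z) acat_scheme \<Rightarrow> 'm \<times> 'm \<Rightarrow> 'm \<times> 'm \<Rightarrow> bool"
  where "ses_iso C s t \<longleftrightarrow> (case s of (f, g) \<Rightarrow> case t of (f', g') \<Rightarrow>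
    short_exact C f g \<and> short_exact C f' g' \<and>
    (\<exists>a b c. isomorphism C a \<and> isomorphism C b \<and> isomorphism C c \<and>
      a \<in> Hom C (Dom C f) (Dom C f') \<and> b \<in> Hom C (Cod C f) (Cod C f') \<and>
      c \<in> Hom C (Cod C g) (Cod C g') \<and>
      b \<cdot>\<^bsub>C\<^esub> f = f' \<cdot>\<^bsub>C\<^esub> a \<and> c \<cdot>\<^bsub>C\<^esub> g = g' \<cdot>\<^bsub>C\<^esub> b))"

definition allowable_class :: "('o, 'm, 'z) acat_scheme \<Rightarrow> ('m \<times> 'm) set \<Rightarrow> bool"
  where "allowable_class C E \<longleftrightarrow>
    (\<forall>f g. (f, g) \<in> E \<longrightarrow> short_exact C f g) \<and>
    (\<forall>s t. s \<in> E \<and> ses_iso C s t \<longrightarrow> t \<in> E) \<and>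
    (\<forall>f g. short_exact C f g \<and>
      (zero_object C (Dom C f) \<or> zero_object C (Cod C f) \<or> zero_object C (Cod C g)) \<longrightarrow>
      (f, g) \<in> E)"

text \<open>As allowable classes are closed under isomorphism, it does not matter which cokernel
  (resp. kernel) is used.\<close>

definition rel_monic :: "('o, 'm, 'z) acat_scheme \<Rightarrow> ('m \<times> 'm) set \<Rightarrow> 'm \<Rightarrow> bool"
  where "rel_monic C E f \<longleftrightarrow> monic C f \<and> (\<exists>c. is_cokernel C c f \<and> (f, c) \<in> E)"

definition rel_epic :: "('o, 'm, 'z) acat_scheme \<Rightarrow> ('m \<times> 'm) set \<Rightarrow> 'm \<Rightarrow> bool"
  where "rel_epic C E f \<longleftrightarrow> epic C f \<and> (\<exists>k. is_kernel C k f \<and> (k, f) \<in> E)"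

definition rel_projective :: "('o, 'm, 'z) acat_scheme \<Rightarrow> ('m \<times> 'm) set \<Rightarrow> 'o \<Rightarrow> bool"
  where "rel_projective C E X \<longleftrightarrow> X \<in> Obj C \<and>
    (\<forall>f. rel_epic C E f \<longrightarrow>
      (\<forall>a \<in> Hom C X (Cod C f). \<exists>b \<in> Hom C X (Dom C f). f \<cdot>\<^bsub>C\<^esub> b = a))"

definition rel_injective :: "('o, 'm, 'z) acat_scheme \<Rightarrow> ('m \<times> 'm) set \<Rightarrow> 'o \<Rightarrow> bool"
  where "rel_injective C E X \<longleftrightarrow> X \<in> Obj C \<and>
    (\<forall>f. rel_monic C E f \<longrightarrow>
      (\<forall>a \<in> Hom C (Dom C f) X. \<exists>b \<in> Hom C (Cod C f) X. b \<cdot>\<^bsub>C\<^esub> f = a))"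

definition enough_projectives :: "('o, 'm, 'z) acat_scheme \<Rightarrow> ('m \<times> 'm) set \<Rightarrow> bool"
  where "enough_projectives C E \<longleftrightarrow>
    (\<forall>M \<in> Obj C. \<exists>f. rel_epic C E f \<and> Cod C f = M \<and> rel_projective C E (Dom C f))"

definition enough_injectives :: "('o, 'm, 'z) acat_scheme \<Rightarrow> ('m \<times> 'm) set \<Rightarrow> bool"
  where "enough_injectives C E \<longleftrightarrow>
    (\<forall>M \<in> Obj C. \<exists>f. rel_monic C E f \<and> Dom C f = M \<and> rel_injective C E (Cod C f))"

definition retractile_monics :: "('o, 'm, 'z) acat_scheme \<Rightarrow> ('m \<times> 'm) set \<Rightarrow> bool"
  where "retractile_monics C E \<longleftrightarrow>
    (\<forall>f \<in> Arr C. \<forall>g \<in> Arr C. Cod C f = Dom C g \<and> rel_monic C E (g \<cdot>\<^bsub>C\<^esub> f) \<longrightarrow> rel_monic C E f)"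

definition sectile_epics :: "('o, 'm, 'z) acat_scheme \<Rightarrow> ('m \<times> 'm) set \<Rightarrow> bool"
  where "sectile_epics C E \<longleftrightarrow>
    (\<forall>f \<in> Arr C. \<forall>g \<in> Arr C. Cod C f = Dom C g \<and> rel_epic C E (g \<cdot>\<^bsub>C\<^esub> f) \<longrightarrow> rel_epic C E g)"

definition stably_equivalent ::
  "('o, 'm, 'z) acat_scheme \<Rightarrow> ('m \<times> 'm) set \<Rightarrow> 'm \<Rightarrow> 'm \<Rightarrow> bool"
  where "stably_equivalent C E f g \<longleftrightarrow> f \<in> Arr C \<and> g \<in> Hom C (Dom C f) (Cod C f) \<and>
    (\<exists>P a b. rel_projective C E P \<and> a \<in> Hom C (Dom C f) P \<and> b \<in> Hom C P (Cod C f) \<and>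
      hom_diff C (Dom C f) (Cod C f) f g = b \<cdot>\<^bsub>C\<^esub> a)"

definition stable_equivalence :: "('o, 'm, 'z) acat_scheme \<Rightarrow> ('m \<times> 'm) set \<Rightarrow> 'm \<Rightarrow> bool"
  where "stable_equivalence C E f \<longleftrightarrow> f \<in> Arr C \<and>
    (\<exists>h \<in> Hom C (Cod C f) (Dom C f).
      stably_equivalent C E (f \<cdot>\<^bsub>C\<^esub> h) (Ident C (Cod C f)) \<and>
      stably_equivalent C E (h \<cdot>\<^bsub>C\<^esub> f) (Ident C (Dom C f)))"

text \<open>In the last clause \<open>u\<close> is the universal map from the pushout of \<open>f\<close> along \<open>\<eta> X\<close>, which is
  determined up to isomorphism by \<open>f\<close>.\<close>

definition functorially_cone_Frobenius ::
  "('o, 'm, 'z) acat_scheme \<Rightarrow> ('m \<times> 'm) set \<Rightarrow> ('m \<times> 'm) set \<Rightarrow> bool"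
  where "functorially_cone_Frobenius C E F \<longleftrightarrow>
    (\<exists>JO JM \<eta>. is_functor C C JO JM \<and> is_nat_trans C C (\<lambda>X. X) (\<lambda>f. f) JO JM \<eta> \<and>
      (\<forall>X \<in> Obj C. rel_projective C E (JO X)) \<and>
      (\<forall>X \<in> Obj C. rel_monic C F (\<eta> X)) \<and>
      (\<forall>f. rel_monic C F f \<longrightarrow> rel_monic C F (JM f) \<and>
        (\<forall>i j u. is_pushout C f (\<eta> (Dom C f)) i j \<and> u \<in> Hom C (Cod C i) (JO (Cod C f)) \<and>
          u \<cdot>\<^bsub>C\<^esub> i = \<eta> (Cod C f) \<and> u \<cdot>\<^bsub>C\<^esub> j = JM f \<longrightarrow> rel_monic C F u)))"


section \<open>Waldhausen categories and cylinder functors\<close>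

text \<open>Pushouts, coproducts and the maps out of them are not chosen: the axioms are required for all
  of them.\<close>

locale waldhausen_category = category C for C :: "('o, 'm, 'z) cat_scheme" (structure) +
  fixes pt :: 'o and cof :: "'m set" and weq :: "'m set"
  assumes pt_zero: "zero_object C pt"
    and ex_pushout: "f \<in> Arr C \<Longrightarrow> g \<in> Arr C \<Longrightarrow> Dom C f = Dom C g \<Longrightarrow>
      \<exists>i j. is_pushout C f g i j"
    and cof_arr: "cof \<subseteq> Arr C"
    and weq_arr: "weq \<subseteq> Arr C"
    and cof_comp: "f \<in> cof \<Longrightarrow> g \<in> cof \<Longrightarrow> Cod C f = Dom C g \<Longrightarrow> g \<cdot> f \<in> cof"
    and weq_comp: "f \<in> weq \<Longrightarrow> g \<in> weq \<Longrightarrow> Cod C f = Dom C g \<Longrightarrow> g \<cdot> f \<in> weq"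
    and Cof1: "isomorphism C f \<Longrightarrow> f \<in> cof"
    and Cof2: "X \<in> Obj C \<Longrightarrow> f \<in> Hom C pt X \<Longrightarrow> f \<in> cof"
    and Cof3: "is_pushout C f g i j \<Longrightarrow> g \<in> cof \<Longrightarrow> i \<in> cof"
    and Weq1: "isomorphism C f \<Longrightarrow> f \<in> weq"
    and Weq2: "is_pushout C f g i j \<Longrightarrow> is_pushout C f' g' i' j' \<Longrightarrow> f \<in> cof \<Longrightarrow> f' \<in> cof \<Longrightarrow>
      a \<in> weq \<Longrightarrow> b \<in> weq \<Longrightarrow> c \<in> weq \<Longrightarrow>
      a \<in> Hom C (Dom C f) (Dom C f') \<Longrightarrow> b \<in> Hom C (Cod C f) (Cod C f') \<Longrightarrow>
      c \<in> Hom C (Cod C g) (Cod C g') \<Longrightarrow>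
      b \<cdot> f = f' \<cdot> a \<Longrightarrow> c \<cdot> g = g' \<cdot> a \<Longrightarrow>
      u \<in> Hom C (Cod C i) (Cod C i') \<Longrightarrow> u \<cdot> i = i' \<cdot> b \<Longrightarrow> u \<cdot> j = j' \<cdot> c \<Longrightarrow> u \<in> weq"

text \<open>A functor from arrows \<open>f : X \<rightarrow> Y\<close> to diagrams on \<open>X\<close>, \<open>Y\<close>, \<open>T f\<close> amounts to a functor \<open>T\<close> from
  the arrow category to \<open>C\<close> together with \<open>j1\<close>, \<open>j2\<close>, \<open>p\<close> that are natural transformations between
  the domain functor, the codomain functor and \<open>T\<close>. The iterated pushout in \<open>Cyl1_cof_pushout\<close>
  is formed as \<open>(X \<squnion>\<^bsub>X'\<^esub> T f') \<squnion>\<^bsub>Y'\<^esub> Y\<close>, with \<open>i\<close>, \<open>i'\<close> and \<open>k\<close>, \<open>k'\<close> the legs of the two pushouts.\<close>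

locale cylinder_functor = waldhausen_category +
  fixes TO :: "'b \<Rightarrow> 'a" and TM :: "'b \<times> ('b \<times> 'b) \<times> 'b \<Rightarrow> 'b"
    and j1 :: "'b \<Rightarrow> 'b" and j2 :: "'b \<Rightarrow> 'b" and p :: "'b \<Rightarrow> 'b"
  assumes T_functor: "is_functor (arrow_category C) C TO TM"
    and j1_nat: "is_nat_trans (arrow_category C) C (Dom C) (\<lambda>(f', (x, y), f). x) TO TM j1"
    and j2_nat: "is_nat_trans (arrow_category C) C (Cod C) (\<lambda>(f', (x, y), f). y) TO TM j2"
    and p_nat: "is_nat_trans (arrow_category C) C TO TM (Cod C) (\<lambda>(f', (x, y), f). y) p"
    and p_j1: "f \<in> Arr C \<Longrightarrow> p f \<cdot> j1 f = f"
    and p_j2: "f \<in> Arr C \<Longrightarrow> p f \<cdot> j2 f = Ident C (Cod C f)"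
    and Cyl1_weq: "(f', (x, y), f) \<in> Arr (arrow_category C) \<Longrightarrow> x \<in> weq \<Longrightarrow> y \<in> weq \<Longrightarrow>
      TM (f', (x, y), f) \<in> weq"
    and Cyl1_cof: "(f', (x, y), f) \<in> Arr (arrow_category C) \<Longrightarrow> x \<in> cof \<Longrightarrow> y \<in> cof \<Longrightarrow>
      TM (f', (x, y), f) \<in> cof"
    and Cyl1_cof_pushout: "(f', (x, y), f) \<in> Arr (arrow_category C) \<Longrightarrow> x \<in> cof \<Longrightarrow> y \<in> cof \<Longrightarrow>
      is_pushout C x (j1 f') i i' \<Longrightarrow> is_pushout C (i' \<cdot> j2 f') y k k' \<Longrightarrow>
      u \<in> Hom C (Cod C k) (TO f) \<Longrightarrow>
      u \<cdot> k \<cdot> i = j1 f \<Longrightarrow> u \<cdot> k \<cdot> i' = TM (f', (x, y), f) \<Longrightarrow> u \<cdot> k' = j2 f \<Longrightarrow>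
      u \<in> cof"
    and Cyl2: "Y \<in> Obj C \<Longrightarrow> f \<in> Hom C pt Y \<Longrightarrow>
      TO f = Y \<and> p f = Ident C Y \<and> j2 f = Ident C Y"
    and Cyl3: "f \<in> Arr C \<Longrightarrow> is_coproduct C (Dom C f) (Cod C f) i1 i2 \<Longrightarrow>
      u \<in> Hom C (Cod C i1) (TO f) \<Longrightarrow> u \<cdot> i1 = j1 f \<Longrightarrow> u \<cdot> i2 = j2 f \<Longrightarrow> u \<in> cof"

definition satisfies_cylinder_axiom ::
  "('o, 'm, 'z) cat_scheme \<Rightarrow> 'm set \<Rightarrow> ('m \<Rightarrow> 'm) \<Rightarrow> bool"
  where "satisfies_cylinder_axiom C weq p \<longleftrightarrow> (\<forall>f \<in> Arr C. p f \<in> weq)"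

end

theory Submission
  imports Defs
begin

text \<open>A cone functor \<open>J\<close> and a cylinder functor \<open>T\<close> determine each other as in topology: \<open>J X\<close> is the
  cylinder of the map from \<open>X\<close> to the zero object, and the cylinder of \<open>f : X \<rightarrow> Y\<close> is the biproduct
  \<open>Y \<oplus> J X\<close>, with front end \<open>(f, \<eta>)\<close>, back end the first inclusion and \<open>p\<close> the first projection.

  The cylinder gives a cone almost by specialisation (\<open>cone_if_cylinder\<close>): the cylinder axiom makes
  \<open>J X\<close> stably equivalent to zero, that is \<open>E\<close>-projective, and the cofibration axioms for squares over
  the zero object are the conditions on \<open>\<eta>\<close>, on \<open>J f\<close> and on the universal map.

  In the other direction, retractile monics and enough injectives show that \<open>f\<close> is \<open>F\<close>-monic as soon
  as every map from its domain to an \<open>F\<close>-injective object extends along \<open>f\<close> (\<open>rel_monicI\<close>). So every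
  cofibration axiom asks for an extension to \<open>Y \<oplus> J X\<close>, i.e. for a map on \<open>Y\<close>, which is always
  prescribed or easily extended, and a map on \<open>J X\<close>, which is given by the defining properties of the
  cone. The universal map enters through \<open>joint_extension\<close>: maps to \<open>F\<close>-injective objects given on
  \<open>Y\<close> and on \<open>J X\<close> and agreeing on \<open>X\<close> have a common extension to \<open>J Y\<close>. Weak equivalences are no
  problem, because \<open>J X\<close> is a projective summand and hence invisible in the stable category.

  One point is strict: the cylinder of \<open>pt \<rightarrow> Y\<close> has to be equal to \<open>Y\<close>, whereas \<open>J pt\<close> may be any
  \<open>E\<close>-projective object. As \<open>pt\<close> is a retract of every \<open>X\<close>, the object \<open>J pt\<close> is a natural direct
  summand of \<open>J X\<close>, cut out by the idempotent \<open>J 0\<close>; the complementary summand is again a cone, and it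
  vanishes on \<open>pt\<close> (\<open>reduced_cone_exists\<close>). Then \<open>Y\<close> itself can be chosen as the biproduct.

  The Waldhausen axioms are part of the claim, and the substantial one is gluing
  (\<open>stable_equivalence_gluing\<close>). A pushout \<open>P\<close> of \<open>Y \<leftarrow> X \<rightarrow> Z\<close> with \<open>X \<rightarrow> Y\<close> an \<open>E\<close>-monic sits in a
  sequence \<open>X \<rightarrow> Y \<oplus> Z \<rightarrow> P\<close> in \<open>E\<close>, so it suffices to compare cokernels
  (\<open>stable_equivalence_cokernel\<close>). Write \<open>[W, -]\<close> for maps modulo those that factor through an
  \<open>E\<close>-projective object, and let \<open>K\<close> be the kernel of an \<open>E\<close>-epic \<open>Q \<rightarrow> W\<close> with \<open>Q\<close> \<open>E\<close>-projective. Since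
  \<open>E\<close>-projectives are \<open>E\<close>-injective, a map from \<open>K\<close> vanishes stably exactly if it extends to \<open>Q\<close>, so
  \<open>[K, -]\<close> plays the part of \<open>Ext\<^sup>1(W, -)\<close>, and for every sequence \<open>X \<rightarrow> Y \<rightarrow> Z\<close> in \<open>E\<close> the sequence
  \<open>[W, X] \<rightarrow> [W, Y] \<rightarrow> [W, Z] \<rightarrow> [K, X] \<rightarrow> [K, Y]\<close> is exact. The five lemma and the Yoneda lemma then
  give the comparison.\<close>

section \<open>Calculus of arrows\<close>

context category
begin

text \<open>Side conditions about composability are left to the simplifier. They are all phrased with \<open>Arr\<close>, \<open>Dom\<close>
  and \<open>Cod\<close>, since membership in \<open>Hom C X Y\<close> would leave the objects as unknowns to be guessed. Composites are
  normalised to nest to the right.\<close>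

lemma in_Hom [simp]: "f \<in> Hom C X Y \<longleftrightarrow> f \<in> Arr C \<and> Dom C f = X \<and> Cod C f = Y"
  by (simp add: Hom_def)

declare dom_obj [simp] cod_obj [simp]

lemma ident_arr [simp]:
  assumes "X \<in> Obj C"
  shows "Ident C X \<in> Arr C" "Dom C (Ident C X) = X" "Cod C (Ident C X) = X"
  using ident_hom[OF assms] by simp_all

lemma comp_arr [simp]:
  assumes "f \<in> Arr C" "g \<in> Arr C" "Cod C f = Dom C g"
  shows "g \<cdot> f \<in> Arr C" "Dom C (g \<cdot> f) = Dom C f" "Cod C (g \<cdot> f) = Cod C g"
  using comp_hom[of f "Dom C f" "Dom C g" g "Cod C g"] assms by simp_all

lemma comp_ident [simp]:
  "f \<in> Arr C \<Longrightarrow> Dom C f = X \<Longrightarrow> f \<cdot> Ident C X = f"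
  "f \<in> Arr C \<Longrightarrow> Cod C f = X \<Longrightarrow> Ident C X \<cdot> f = f"
  using ident_right[of f "Dom C f" "Cod C f"] ident_left[of f "Dom C f" "Cod C f"] by auto

lemma comp_comp [simp]:
  assumes "f \<in> Arr C" "g \<in> Arr C" "h \<in> Arr C" "Cod C f = Dom C g" "Cod C g = Dom C h"
  shows "(h \<cdot> g) \<cdot> f = h \<cdot> (g \<cdot> f)"
  using comp_assoc[of f "Dom C f" "Dom C g" g "Dom C h" h "Cod C h"] assms by simp

text \<open>With composites nested to the right, an equation \<open>g \<cdot> f = h\<close> no longer matches inside
  \<open>g \<cdot> (f \<cdot> x)\<close>. The following three rules extend such equations by a further factor \<open>x\<close>.\<close>

lemma comp_ident_cancel:
  assumes "g \<cdot> f = Ident C X" "x \<in> Arr C" "f \<in> Arr C" "g \<in> Arr C"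
    "Cod C x = Dom C f" "Cod C f = Dom C g" "Cod C x = X"
  shows "g \<cdot> (f \<cdot> x) = x"
  using assms by (metis comp_comp comp_ident(2))

lemma comp_eq_extend:
  assumes "g \<cdot> f = g' \<cdot> f'" "x \<in> Arr C" "f \<in> Arr C" "g \<in> Arr C" "f' \<in> Arr C" "g' \<in> Arr C"
    "Cod C x = Dom C f" "Cod C f = Dom C g" "Dom C f' = Dom C f" "Cod C f' = Dom C g'"
  shows "g \<cdot> (f \<cdot> x) = g' \<cdot> (f' \<cdot> x)"
  using assms by (metis comp_comp)

lemma comp_eq_extend1:
  assumes "g \<cdot> f = h" "x \<in> Arr C" "f \<in> Arr C" "g \<in> Arr C"
    "Cod C x = Dom C f" "Cod C f = Dom C g"
  shows "g \<cdot> (f \<cdot> x) = h \<cdot> x"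
  using assms by (metis comp_comp)

end

context preadditive_category
begin

abbreviation add (infixl "\<oplus>" 65)
  where "f \<oplus> g \<equiv> Add C f g"

text \<open>The inverse in \<open>hom_group\<close> needs the two objects as parameters; they are read off from the arrow, so that
  negation is a plain operation on arrows.\<close>

definition neg ("\<ominus> _" [81] 80)
  where "\<ominus> f = inv\<^bsub>hom_group C (Dom C f) (Cod C f)\<^esub> f"

lemma zero_arr [simp]:
  assumes "X \<in> Obj C" "Y \<in> Obj C"
  shows "Zero C X Y \<in> Arr C" "Dom C (Zero C X Y) = X" "Cod C (Zero C X Y) = Y"
  using monoid.one_closed[OF group.is_monoid[OF comm_group.axioms(2)[OF hom_comm_group[OF assms]]]]
  by (simp_all add: hom_group_def)

lemma hom_comm_group_at: "f \<in> Arr C \<Longrightarrow> comm_group (hom_group C (Dom C f) (Cod C f))"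
  by (rule hom_comm_group) simp_all

lemma add_arr [simp]:
  assumes "f \<in> Arr C" "g \<in> Arr C" "Dom C f = Dom C g" "Cod C f = Cod C g"
  shows "f \<oplus> g \<in> Arr C" "Dom C (f \<oplus> g) = Dom C g" "Cod C (f \<oplus> g) = Cod C g"
proof -
  interpret G: comm_group "hom_group C (Dom C f) (Cod C f)"
    using assms(1) by (rule hom_comm_group_at)
  show "f \<oplus> g \<in> Arr C" "Dom C (f \<oplus> g) = Dom C g" "Cod C (f \<oplus> g) = Cod C g"
    using G.m_closed[of f g] assms by (simp_all add: hom_group_def)
qed

lemma neg_arr [simp]:
  assumes "f \<in> Arr C"
  shows "\<ominus> f \<in> Arr C" "Dom C (\<ominus> f) = Dom C f" "Cod C (\<ominus> f) = Cod C f"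
proof -
  interpret G: comm_group "hom_group C (Dom C f) (Cod C f)"
    using assms(1) by (rule hom_comm_group_at)
  show "\<ominus> f \<in> Arr C" "Dom C (\<ominus> f) = Dom C f" "Cod C (\<ominus> f) = Cod C f"
    using G.inv_closed[of f] assms by (simp_all add: hom_group_def neg_def)
qed

lemma add_assoc:
  assumes "f \<in> Arr C" "g \<in> Arr C" "h \<in> Arr C" "Dom C f = Dom C g" "Cod C f = Cod C g"
    "Dom C g = Dom C h" "Cod C g = Cod C h"
  shows "(f \<oplus> g) \<oplus> h = f \<oplus> (g \<oplus> h)"
proof -
  interpret G: comm_group "hom_group C (Dom C f) (Cod C f)"
    using assms(1) by (rule hom_comm_group_at)
  show ?thesis
    using G.m_assoc[of f g h] assms by (simp add: hom_group_def)
qed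

lemma add_commute:
  assumes "f \<in> Arr C" "g \<in> Arr C" "Dom C f = Dom C g" "Cod C f = Cod C g"
  shows "f \<oplus> g = g \<oplus> f"
proof -
  interpret G: comm_group "hom_group C (Dom C f) (Cod C f)"
    using assms(1) by (rule hom_comm_group_at)
  show ?thesis
    using G.m_comm[of f g] assms by (simp add: hom_group_def)
qed

lemma add_left_commute:
  assumes "f \<in> Arr C" "g \<in> Arr C" "h \<in> Arr C" "Dom C f = Dom C g" "Cod C f = Cod C g"
    "Dom C g = Dom C h" "Cod C g = Cod C h"
  shows "f \<oplus> (g \<oplus> h) = g \<oplus> (f \<oplus> h)"
  using assms add_assoc[of f g h] add_assoc[of g f h] add_commute[of f g] by simp

lemmas add_ac = add_assoc add_commute add_left_commute

lemma add_zero [simp]: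
  assumes "f \<in> Arr C" "Dom C f = X" "Cod C f = Y"
  shows "Zero C X Y \<oplus> f = f" "f \<oplus> Zero C X Y = f"
proof -
  interpret G: comm_group "hom_group C (Dom C f) (Cod C f)"
    using assms(1) by (rule hom_comm_group_at)
  show "Zero C X Y \<oplus> f = f" "f \<oplus> Zero C X Y = f"
    using G.l_one[of f] G.r_one[of f] assms by (simp_all add: hom_group_def)
qed

lemma add_neg [simp]:
  assumes "f \<in> Arr C"
  shows "f \<oplus> \<ominus> f = Zero C (Dom C f) (Cod C f)" "\<ominus> f \<oplus> f = Zero C (Dom C f) (Cod C f)"
proof -
  interpret G: comm_group "hom_group C (Dom C f) (Cod C f)"
    using assms(1) by (rule hom_comm_group_at)
  show "f \<oplus> \<ominus> f = Zero C (Dom C f) (Cod C f)" "\<ominus> f \<oplus> f = Zero C (Dom C f) (Cod C f)"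
    using G.l_inv[of f] G.r_inv[of f] assms by (simp_all add: hom_group_def neg_def)
qed

lemma add_neg_cancel [simp]:
  assumes "f \<in> Arr C" "g \<in> Arr C" "Dom C f = Dom C g" "Cod C f = Cod C g"
  shows "f \<oplus> (\<ominus> f \<oplus> g) = g" "\<ominus> f \<oplus> (f \<oplus> g) = g"
    "(g \<oplus> f) \<oplus> \<ominus> f = g" "(g \<oplus> \<ominus> f) \<oplus> f = g"
  using assms add_assoc[of f "\<ominus> f" g] add_assoc[of "\<ominus> f" f g]
    add_assoc[of g f "\<ominus> f"] add_assoc[of g "\<ominus> f" f] by simp_all

lemma add_eq_self:
  assumes "f \<in> Arr C" "g \<in> Arr C" "Dom C f = Dom C g" "Cod C f = Cod C g" "f \<oplus> g = f"
  shows "g = Zero C (Dom C f) (Cod C f)"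
  using assms add_neg_cancel(2)[of f g] add_neg(2)[of f] by metis

lemma sub_eq_zeroD:
  assumes "f \<oplus> \<ominus> g = Zero C X Y" "f \<in> Arr C" "g \<in> Arr C" "Dom C f = X" "Dom C g = X"
    "Cod C f = Y" "Cod C g = Y"
  shows "f = g"
  using assms add_neg_cancel(4)[of g f] add_zero(1)[of g X Y] by metis

lemma neg_unique:
  assumes "f \<in> Arr C" "g \<in> Arr C" "Dom C f = Dom C g" "Cod C f = Cod C g"
    "f \<oplus> g = Zero C (Dom C g) (Cod C g)"
  shows "\<ominus> f = g"
  using assms add_neg_cancel(2)[of f g] by simp

lemma neg_neg [simp]: "f \<in> Arr C \<Longrightarrow> \<ominus> (\<ominus> f) = f"
  by (rule neg_unique) simp_all

lemma neg_zero [simp]: "X \<in> Obj C \<Longrightarrow> Y \<in> Obj C \<Longrightarrow> \<ominus> (Zero C X Y) = Zero C X Y"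
  by (rule neg_unique) simp_all

lemma neg_add [simp]:
  assumes "f \<in> Arr C" "g \<in> Arr C" "Dom C f = Dom C g" "Cod C f = Cod C g"
  shows "\<ominus> (f \<oplus> g) = \<ominus> f \<oplus> \<ominus> g"
proof (rule neg_unique)
  have "f \<oplus> g \<oplus> (\<ominus> f \<oplus> \<ominus> g) = f \<oplus> (\<ominus> f \<oplus> (g \<oplus> \<ominus> g))"
    using assms by (simp add: add_ac del: add_neg)
  then show "f \<oplus> g \<oplus> (\<ominus> f \<oplus> \<ominus> g) = Zero C (Dom C (\<ominus> f \<oplus> \<ominus> g)) (Cod C (\<ominus> f \<oplus> \<ominus> g))"
    using assms by simp
qed (use assms in simp_all)

lemma comp_add [simp]:
  assumes "g \<in> Arr C" "g' \<in> Arr C" "Dom C g = Dom C g'" "Cod C g = Cod C g'" "f \<in> Arr C"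
  shows "Cod C f = Dom C g' \<Longrightarrow> (g \<oplus> g') \<cdot> f = g \<cdot> f \<oplus> g' \<cdot> f"
    "Dom C f = Cod C g' \<Longrightarrow> f \<cdot> (g \<oplus> g') = f \<cdot> g \<oplus> f \<cdot> g'"
  using assms comp_add_left[of f "Dom C f" "Dom C g" g "Cod C g" g']
    comp_add_right[of g "Dom C g" "Cod C g" g' f "Cod C f"] by simp_all

lemma comp_zero [simp]:
  assumes "f \<in> Arr C" "X \<in> Obj C"
  shows "Cod C f = Y \<Longrightarrow> Zero C Y X \<cdot> f = Zero C (Dom C f) X"
    "Dom C f = Y \<Longrightarrow> f \<cdot> Zero C X Y = Zero C X (Cod C f)"
proof -
  show "Zero C Y X \<cdot> f = Zero C (Dom C f) X" if "Cod C f = Y"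
  proof -
    have "Y \<in> Obj C"
      using assms that cod_obj by blast
    then show ?thesis
      using add_eq_self[of "Zero C Y X \<cdot> f" "Zero C Y X \<cdot> f"] comp_add(1)[of "Zero C Y X" "Zero C Y X" f] assms that
      by simp
  qed
  show "f \<cdot> Zero C X Y = Zero C X (Cod C f)" if "Dom C f = Y"
  proof -
    have "Y \<in> Obj C"
      using assms that dom_obj by blast
    then show ?thesis
      using add_eq_self[of "f \<cdot> Zero C X Y" "f \<cdot> Zero C X Y"] comp_add(2)[of "Zero C X Y" "Zero C X Y" f] assms that
      by simp
  qed
qed

lemma comp_neg [simp]:
  assumes "g \<in> Arr C" "f \<in> Arr C" "Cod C f = Dom C g"
  shows "(\<ominus> g) \<cdot> f = \<ominus> (g \<cdot> f)" "g \<cdot> (\<ominus> f) = \<ominus> (g \<cdot> f)"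
proof -
  have "g \<cdot> f \<oplus> (\<ominus> g) \<cdot> f = (g \<oplus> \<ominus> g) \<cdot> f"
    using assms by (subst comp_add(1)) simp_all
  then show "(\<ominus> g) \<cdot> f = \<ominus> (g \<cdot> f)"
    using assms by (intro neg_unique[symmetric]) simp_all
  have "g \<cdot> f \<oplus> g \<cdot> (\<ominus> f) = g \<cdot> (f \<oplus> \<ominus> f)"
    using assms by (subst comp_add(2)) simp_all
  then show "g \<cdot> (\<ominus> f) = \<ominus> (g \<cdot> f)"
    using assms by (intro neg_unique[symmetric]) simp_all
qed

lemma hom_diff_eq:
  "g \<in> Arr C \<Longrightarrow> Dom C g = X \<Longrightarrow> Cod C g = Y \<Longrightarrow> hom_diff C X Y f g = f \<oplus> \<ominus> g"
  by (simp add: hom_diff_def neg_def)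

lemma zero_object_arr_eq:
  assumes "zero_object C Z" "f \<in> Arr C"
  shows "Dom C f = Z \<Longrightarrow> f = Zero C Z (Cod C f)" "Cod C f = Z \<Longrightarrow> f = Zero C (Dom C f) Z"
proof -
  have Z: "Z \<in> Obj C"
    using assms(1) by (simp add: zero_object_def)
  show "f = Zero C Z (Cod C f)" if "Dom C f = Z"
  proof -
    have "\<exists>!h. h \<in> Hom C Z (Cod C f)"
      using assms by (simp add: zero_object_def)
    then show ?thesis
      using that Z assms(2) by (metis cod_obj in_Hom zero_arr)
  qed
  show "f = Zero C (Dom C f) Z" if "Cod C f = Z"
  proof -
    have "\<exists>!h. h \<in> Hom C (Dom C f) Z"
      using assms by (simp add: zero_object_def)
    then show ?thesis
      using that Z assms(2) by (metis dom_obj in_Hom zero_arr)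
  qed
qed

lemma ident_zero_object: "zero_object C Z \<Longrightarrow> Ident C Z = Zero C Z Z"
  using zero_object_arr_eq(1)[of Z "Ident C Z"] by (simp add: zero_object_def)

lemma zero_objectI:
  assumes "Z \<in> Obj C" "Ident C Z = Zero C Z Z"
  shows "zero_object C Z"
  unfolding zero_object_def
proof (intro conjI ballI)
  fix X assume X: "X \<in> Obj C"
  show "\<exists>!f. f \<in> Hom C Z X"
  proof (rule ex1I[of _ "Zero C Z X"])
    show "f = Zero C Z X" if "f \<in> Hom C Z X" for f
      using that assms X comp_ident(1)[of f Z] by (simp del: comp_ident)
  qed (use assms X in simp)
  show "\<exists>!f. f \<in> Hom C X Z"
  proof (rule ex1I[of _ "Zero C X Z"])
    show "f = Zero C X Z" if "f \<in> Hom C X Z" for f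
      using that assms X comp_ident(2)[of f Z] by (simp del: comp_ident)
  qed (use assms X in simp)
qed (rule assms(1))

end


section \<open>Biproducts and pushouts\<close>

context category
begin

lemma monicI:
  assumes "f \<in> Arr C"
    "\<And>a b. \<lbrakk>a \<in> Arr C; b \<in> Arr C; Dom C a = Dom C b; Cod C a = Dom C f; Cod C b = Dom C f;
      f \<cdot> a = f \<cdot> b\<rbrakk> \<Longrightarrow> a = b"
  shows "monic C f"
  using assms unfolding monic_def by blast

lemma monicD:
  assumes "monic C f" "f \<cdot> a = f \<cdot> b" "a \<in> Arr C" "b \<in> Arr C"
    "Dom C a = Dom C b" "Cod C a = Dom C f" "Cod C b = Dom C f"
  shows "a = b"
  using assms unfolding monic_def by blast

lemma epicD:
  assumes "epic C f" "a \<cdot> f = b \<cdot> f" "a \<in> Arr C" "b \<in> Arr C"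
    "Cod C a = Cod C b" "Dom C a = Cod C f" "Dom C b = Cod C f"
  shows "a = b"
  using assms unfolding epic_def by blast

end

context preadditive_category
begin

lemma kernelD:
  assumes "is_kernel C k f"
  shows "k \<in> Arr C" "f \<in> Arr C" "Cod C k = Dom C f" "f \<cdot> k = Zero C (Dom C k) (Cod C f)"
  using assms by (simp_all add: is_kernel_def)

lemma cokernelD:
  assumes "is_cokernel C c f"
  shows "c \<in> Arr C" "f \<in> Arr C" "Dom C c = Cod C f" "c \<cdot> f = Zero C (Dom C f) (Cod C c)"
  using assms by (simp_all add: is_cokernel_def)

lemma kernel_factor:
  assumes "is_kernel C k f" "h \<in> Arr C" "Cod C h = Dom C f" "f \<cdot> h = Zero C (Dom C h) (Cod C f)"
  obtains u where "u \<in> Arr C" "Dom C u = Dom C h" "Cod C u = Dom C k" "k \<cdot> u = h"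
  using assms unfolding is_kernel_def in_Hom by metis

lemma cokernel_factor:
  assumes "is_cokernel C c f" "h \<in> Arr C" "Dom C h = Cod C f"
    "h \<cdot> f = Zero C (Dom C f) (Cod C h)"
  obtains u where "u \<in> Arr C" "Dom C u = Cod C c" "Cod C u = Cod C h" "u \<cdot> c = h"
  using assms unfolding is_cokernel_def in_Hom by metis

lemma kernel_monic:
  assumes "is_kernel C k f"
  shows "monic C k"
proof (rule monicI)
  note kernelD[OF assms, simp]
  fix a b
  assume ab: "a \<in> Arr C" "b \<in> Arr C" "Dom C a = Dom C b" "Cod C a = Dom C k" "Cod C b = Dom C k"
    "k \<cdot> a = k \<cdot> b"
  have "f \<cdot> (k \<cdot> b) = Zero C (Dom C (k \<cdot> b)) (Cod C f)"
    using ab by (simp add: comp_eq_extend1[OF kernelD(4)[OF assms]])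
  then have "\<exists>!u. u \<in> Hom C (Dom C (k \<cdot> b)) (Dom C k) \<and> k \<cdot> u = k \<cdot> b"
    using assms ab unfolding is_kernel_def by (metis comp_arr kernelD(1,3)[OF assms])
  then show "a = b"
    using ab by auto
qed (use kernelD(1)[OF assms] in simp)

lemma cokernel_epic:
  assumes "is_cokernel C c f"
  shows "epic C c"
  unfolding epic_def
proof (intro conjI ballI impI)
  note cokernelD[OF assms, simp]
  show "c \<in> Arr C"
    by simp
  fix a b
  assume ab: "a \<in> Arr C" "b \<in> Arr C"
    "Cod C a = Cod C b \<and> Dom C a = Cod C c \<and> Dom C b = Cod C c \<and> a \<cdot> c = b \<cdot> c"
  have "(b \<cdot> c) \<cdot> f = Zero C (Dom C f) (Cod C (b \<cdot> c))"
    using ab by simp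
  then have "\<exists>!u. u \<in> Hom C (Cod C c) (Cod C (b \<cdot> c)) \<and> u \<cdot> c = b \<cdot> c"
    using assms ab unfolding is_cokernel_def by (metis comp_arr cokernelD(1,3)[OF assms])
  then show "a = b"
    using ab by auto
qed

end

text \<open>The orthogonality relations \<open>p1 \<cdot> i2 = 0\<close> and \<open>p2 \<cdot> i1 = 0\<close> are not among the axioms of
  \<open>is_biproduct\<close>, but they follow from the three equations there.\<close>

locale biproduct = preadditive_category +
  fixes X Y P i1 i2 p1 p2
  assumes biproduct: "is_biproduct C X Y P i1 i2 p1 p2"
begin

lemma biproduct_arr [simp]:
  "P \<in> Obj C" "i1 \<in> Arr C" "Dom C i1 = X" "Cod C i1 = P" "i2 \<in> Arr C" "Dom C i2 = Y" "Cod C i2 = P"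
  "p1 \<in> Arr C" "Dom C p1 = P" "Cod C p1 = X" "p2 \<in> Arr C" "Dom C p2 = P" "Cod C p2 = Y"
  using biproduct by (simp_all add: is_biproduct_def)

lemma biproduct_obj [simp]: "X \<in> Obj C" "Y \<in> Obj C"
  using dom_obj[of i1] dom_obj[of i2] by simp_all

lemma biproduct_ident [simp]: "p1 \<cdot> i1 = Ident C X" "p2 \<cdot> i2 = Ident C Y"
  and biproduct_sum: "i1 \<cdot> p1 \<oplus> i2 \<cdot> p2 = Ident C P"
  using biproduct by (simp_all add: is_biproduct_def)

lemma biproduct_sum_comp:
  assumes "h \<in> Arr C" "Cod C h = P"
  shows "i1 \<cdot> (p1 \<cdot> h) \<oplus> i2 \<cdot> (p2 \<cdot> h) = h"
proof -
  have "(i1 \<cdot> p1 \<oplus> i2 \<cdot> p2) \<cdot> h = h"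
    using assms by (simp only: biproduct_sum) simp
  then show ?thesis
    using assms by simp
qed

lemma biproduct_comp_sum:
  assumes "h \<in> Arr C" "Dom C h = P"
  shows "h \<cdot> (i1 \<cdot> p1) \<oplus> h \<cdot> (i2 \<cdot> p2) = h"
proof -
  have "h \<cdot> (i1 \<cdot> p1 \<oplus> i2 \<cdot> p2) = h"
    using assms by (simp only: biproduct_sum) simp
  then show ?thesis
    using assms by simp
qed

lemma biproduct_zero [simp]: "p1 \<cdot> i2 = Zero C Y X" "p2 \<cdot> i1 = Zero C X Y"
proof -
  \<comment> \<open>The identity of \<open>P\<close>, composed with \<open>i1\<close>, reads \<open>i1 \<oplus> i2 \<cdot> p2 \<cdot> i1 = i1\<close>.\<close>
  have "i1 \<cdot> (p1 \<cdot> i1) \<oplus> i2 \<cdot> (p2 \<cdot> i1) = i1"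
    by (rule biproduct_sum_comp) simp_all
  then have "i2 \<cdot> (p2 \<cdot> i1) = Zero C X P"
    using add_eq_self[of i1 "i2 \<cdot> (p2 \<cdot> i1)"] by simp
  then have "p2 \<cdot> (i2 \<cdot> (p2 \<cdot> i1)) = Zero C X Y"
    by simp
  then show "p2 \<cdot> i1 = Zero C X Y"
    by (simp add: comp_ident_cancel[OF biproduct_ident(2)])
  have "i1 \<cdot> (p1 \<cdot> i2) \<oplus> i2 \<cdot> (p2 \<cdot> i2) = i2"
    by (rule biproduct_sum_comp) simp_all
  then have "i1 \<cdot> (p1 \<cdot> i2) = Zero C Y P"
    using add_eq_self[of i2 "i1 \<cdot> (p1 \<cdot> i2)"] by (simp add: add_commute)
  then have "p1 \<cdot> (i1 \<cdot> (p1 \<cdot> i2)) = Zero C Y X"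
    by simp
  then show "p1 \<cdot> i2 = Zero C Y X"
    by (simp add: comp_ident_cancel[OF biproduct_ident(1)])
qed

lemma biproduct_comp [simp]:
  assumes "h \<in> Arr C"
  shows "Cod C h = X \<Longrightarrow> p1 \<cdot> (i1 \<cdot> h) = h" "Cod C h = Y \<Longrightarrow> p2 \<cdot> (i2 \<cdot> h) = h"
    "Cod C h = Y \<Longrightarrow> p1 \<cdot> (i2 \<cdot> h) = Zero C (Dom C h) X"
    "Cod C h = X \<Longrightarrow> p2 \<cdot> (i1 \<cdot> h) = Zero C (Dom C h) Y"
  using assms comp_ident_cancel[OF biproduct_ident(1), of h]
    comp_ident_cancel[OF biproduct_ident(2), of h]
    comp_eq_extend1[OF biproduct_zero(1), of h] comp_eq_extend1[OF biproduct_zero(2), of h]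
  by simp_all

lemma out_eqI:
  assumes "h \<in> Arr C" "h' \<in> Arr C" "Dom C h = P" "Dom C h' = P" "Cod C h = Cod C h'"
    "h \<cdot> i1 = h' \<cdot> i1" "h \<cdot> i2 = h' \<cdot> i2"
  shows "h = h'"
proof -
  have "(h \<cdot> i1) \<cdot> p1 \<oplus> (h \<cdot> i2) \<cdot> p2 = (h' \<cdot> i1) \<cdot> p1 \<oplus> (h' \<cdot> i2) \<cdot> p2"
    by (simp only: assms(6,7))
  then show ?thesis
    using assms(1-5) biproduct_comp_sum[of h] biproduct_comp_sum[of h'] by simp
qed

end

context preadditive_category
begin

lemma pushoutD:
  assumes "is_pushout C f g i j"
  shows "f \<in> Arr C" "g \<in> Arr C" "i \<in> Arr C" "j \<in> Arr C" "Dom C f = Dom C g"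
    "Dom C i = Cod C f" "Dom C j = Cod C g" "Cod C i = Cod C j" "i \<cdot> f = j \<cdot> g"
  using assms by (simp_all add: is_pushout_def)

lemma pushout_ex1:
  assumes "is_pushout C f g i j" "a \<in> Arr C" "b \<in> Arr C" "Dom C a = Cod C f" "Dom C b = Cod C g"
    "Cod C a = Cod C b" "a \<cdot> f = b \<cdot> g"
  shows "\<exists>!u. u \<in> Hom C (Cod C i) (Cod C b) \<and> u \<cdot> i = a \<and> u \<cdot> j = b"
proof -
  have "\<forall>W \<in> Obj C. \<forall>a \<in> Hom C (Cod C f) W. \<forall>b \<in> Hom C (Cod C g) W. a \<cdot> f = b \<cdot> g \<longrightarrow>
      (\<exists>!u. u \<in> Hom C (Cod C i) W \<and> u \<cdot> i = a \<and> u \<cdot> j = b)"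
    using assms(1) unfolding is_pushout_def by blast
  moreover have "Cod C b \<in> Obj C" "a \<in> Hom C (Cod C f) (Cod C b)" "b \<in> Hom C (Cod C g) (Cod C b)"
    using assms by simp_all
  ultimately show ?thesis
    using assms(7) by blast
qed

lemma pushout_factor:
  assumes "is_pushout C f g i j" "a \<in> Arr C" "b \<in> Arr C" "Dom C a = Cod C f" "Dom C b = Cod C g"
    "Cod C a = Cod C b" "a \<cdot> f = b \<cdot> g"
  obtains u where "u \<in> Arr C" "Dom C u = Cod C i" "Cod C u = Cod C b" "u \<cdot> i = a" "u \<cdot> j = b"
  using pushout_ex1[OF assms] that by auto

lemma pushout_eqI:
  assumes "is_pushout C f g i j" "u \<in> Arr C" "v \<in> Arr C" "Dom C u = Cod C i" "Dom C v = Cod C i"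
    "Cod C u = Cod C v" "u \<cdot> i = v \<cdot> i" "u \<cdot> j = v \<cdot> j"
  shows "u = v"
proof -
  note pushoutD[OF assms(1), simp] assms(2-6)[simp]
  have "(v \<cdot> i) \<cdot> f = (v \<cdot> j) \<cdot> g"
    by simp
  then have "\<exists>!u. u \<in> Hom C (Cod C i) (Cod C (v \<cdot> j)) \<and> u \<cdot> i = v \<cdot> i \<and> u \<cdot> j = v \<cdot> j"
    by (intro pushout_ex1[OF assms(1)]) simp_all
  moreover have "u \<in> Hom C (Cod C i) (Cod C (v \<cdot> j))" "v \<in> Hom C (Cod C i) (Cod C (v \<cdot> j))"
    by simp_all
  ultimately show ?thesis
    using assms(7,8) by blast
qed

end

context biproduct
begin

text \<open>A cocone on the span \<open>f\<close>, \<open>g\<close> is the same as a map out of the biproduct that vanishes on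
  \<open>(f, - g)\<close>. This and the converse construction below turn pushouts into cokernels.\<close>

lemma pushout_cokernel:
  assumes "is_pushout C f g i j" "Cod C f = X" "Cod C g = Y"
  shows "is_cokernel C (i \<cdot> p1 \<oplus> j \<cdot> p2) (i1 \<cdot> f \<oplus> \<ominus> (i2 \<cdot> g))"
  unfolding is_cokernel_def
proof (intro conjI ballI impI)
  note pushoutD[OF assms(1), simp] assms(2,3)[simp]
  fix h assume "h \<in> Arr C" and h: "Dom C h = Cod C (i1 \<cdot> f \<oplus> \<ominus> (i2 \<cdot> g)) \<and>
    h \<cdot> (i1 \<cdot> f \<oplus> \<ominus> (i2 \<cdot> g)) = Zero C (Dom C (i1 \<cdot> f \<oplus> \<ominus> (i2 \<cdot> g))) (Cod C h)"
  then have [simp]: "h \<in> Arr C" "Dom C h = P"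
    by simp_all
  have "h \<cdot> (i1 \<cdot> f) = h \<cdot> (i2 \<cdot> g)"
    by (rule sub_eq_zeroD[of _ _ "Dom C g" "Cod C h"]) (use h in simp_all)
  then obtain u where u [simp]: "u \<in> Arr C" "Dom C u = Cod C j" "Cod C u = Cod C h"
    and ui: "u \<cdot> i = h \<cdot> i1" and uj: "u \<cdot> j = h \<cdot> i2"
    using pushout_factor[OF assms(1), of "h \<cdot> i1" "h \<cdot> i2"] by auto
  show "\<exists>!u. u \<in> Hom C (Cod C (i \<cdot> p1 \<oplus> j \<cdot> p2)) (Cod C h) \<and> u \<cdot> (i \<cdot> p1 \<oplus> j \<cdot> p2) = h"
  proof (rule ex1I[of _ u])
    have "u \<cdot> (i \<cdot> p1 \<oplus> j \<cdot> p2) = h"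
      by (rule out_eqI) (simp_all add: ui uj)
    then show "u \<in> Hom C (Cod C (i \<cdot> p1 \<oplus> j \<cdot> p2)) (Cod C h) \<and> u \<cdot> (i \<cdot> p1 \<oplus> j \<cdot> p2) = h"
      by simp
    fix v assume v: "v \<in> Hom C (Cod C (i \<cdot> p1 \<oplus> j \<cdot> p2)) (Cod C h) \<and> v \<cdot> (i \<cdot> p1 \<oplus> j \<cdot> p2) = h"
    then have [simp]: "v \<in> Arr C" "Dom C v = Cod C j" "Cod C v = Cod C h"
      by simp_all
    have "(v \<cdot> (i \<cdot> p1 \<oplus> j \<cdot> p2)) \<cdot> i1 = h \<cdot> i1" "(v \<cdot> (i \<cdot> p1 \<oplus> j \<cdot> p2)) \<cdot> i2 = h \<cdot> i2"
      using v by simp_all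
    then show "v = u"
      using pushout_eqI[OF assms(1), of v u] by (simp add: ui uj)
  qed
qed (use assms pushoutD[OF assms(1)] in simp_all)

lemma cokernel_pushout:
  assumes "is_cokernel C c (i1 \<cdot> f \<oplus> \<ominus> (i2 \<cdot> g))" "f \<in> Arr C" "g \<in> Arr C" "Dom C f = Dom C g"
    "Cod C f = X" "Cod C g = Y"
  shows "is_pushout C f g (c \<cdot> i1) (c \<cdot> i2)"
  unfolding is_pushout_def
proof (intro conjI ballI impI)
  note assms(2-6)[simp] cokernelD(1,3)[OF assms(1), simp]
  show "(c \<cdot> i1) \<cdot> f = (c \<cdot> i2) \<cdot> g"
    using cokernelD(4)[OF assms(1)] sub_eq_zeroD[of "c \<cdot> (i1 \<cdot> f)" "c \<cdot> (i2 \<cdot> g)"] by simp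
  fix W a b
  assume "W \<in> Obj C" "a \<in> Hom C (Cod C f) W" "b \<in> Hom C (Cod C g) W" and ab: "a \<cdot> f = b \<cdot> g"
  then have [simp]: "W \<in> Obj C" "a \<in> Arr C" "Dom C a = X" "Cod C a = W"
    "b \<in> Arr C" "Dom C b = Y" "Cod C b = W"
    by simp_all
  define h where "h = a \<cdot> p1 \<oplus> b \<cdot> p2"
  have [simp]: "h \<in> Arr C" "Dom C h = P" "Cod C h = W" "h \<cdot> i1 = a" "h \<cdot> i2 = b"
    by (simp_all add: h_def)
  have "h \<cdot> (i1 \<cdot> f \<oplus> \<ominus> (i2 \<cdot> g)) = Zero C (Dom C g) W"
    using ab by (simp add: h_def)
  then obtain u where u: "u \<in> Arr C" "Dom C u = Cod C c" "Cod C u = W" "u \<cdot> c = h"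
    using cokernel_factor[OF assms(1), of h] by auto
  show "\<exists>!u. u \<in> Hom C (Cod C (c \<cdot> i1)) W \<and> u \<cdot> c \<cdot> i1 = a \<and> u \<cdot> c \<cdot> i2 = b"
  proof (rule ex1I[of _ u])
    have "(u \<cdot> c) \<cdot> i1 = a" "(u \<cdot> c) \<cdot> i2 = b"
      using u(4) by simp_all
    then show "u \<in> Hom C (Cod C (c \<cdot> i1)) W \<and> u \<cdot> c \<cdot> i1 = a \<and> u \<cdot> c \<cdot> i2 = b"
      using u(1-3) by simp
    fix v assume v: "v \<in> Hom C (Cod C (c \<cdot> i1)) W \<and> v \<cdot> c \<cdot> i1 = a \<and> v \<cdot> c \<cdot> i2 = b"
    have "v \<cdot> c = h"
      by (rule out_eqI) (use v in simp_all)
    then show "v = u"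
      using u v epicD[OF cokernel_epic[OF assms(1)], of v u] by simp
  qed
qed (use assms cokernelD[OF assms(1)] in simp_all)

end

context abelian_category
begin

lemma obtain_biproduct:
  assumes "X \<in> Obj C" "Y \<in> Obj C"
  obtains P i1 i2 p1 p2 where "biproduct C X Y P i1 i2 p1 p2"
proof -
  obtain P i1 i2 p1 p2 where "is_biproduct C X Y P i1 i2 p1 p2"
    using ex_biproduct[OF assms] by blast
  then have "biproduct C X Y P i1 i2 p1 p2"
    by unfold_locales
  then show ?thesis
    by (rule that)
qed

lemma pushout_exists:
  assumes "f \<in> Arr C" "g \<in> Arr C" "Dom C f = Dom C g"
  shows "\<exists>i j. is_pushout C f g i j"
proof -
  obtain P i1 i2 p1 p2 where "biproduct C (Cod C f) (Cod C g) P i1 i2 p1 p2"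
    using obtain_biproduct[OF cod_obj[OF assms(1)] cod_obj[OF assms(2)]] by blast
  then interpret biproduct C "Cod C f" "Cod C g" P i1 i2 p1 p2 .
  obtain c where "is_cokernel C c (i1 \<cdot> f \<oplus> \<ominus> (i2 \<cdot> g))"
    using ex_cokernel[of "i1 \<cdot> f \<oplus> \<ominus> (i2 \<cdot> g)"] assms by auto
  from cokernel_pushout[OF this assms] show ?thesis
    by blast
qed

end


section \<open>Relative monomorphisms and relative projectives\<close>

context category
begin

lemma isomorphism_ident: "X \<in> Obj C \<Longrightarrow> isomorphism C (Ident C X)"
  unfolding isomorphism_def by (auto intro!: bexI[of _ "Ident C X"])

lemma isomorphismE:
  assumes "isomorphism C f"
  obtains g where "f \<in> Arr C" "g \<in> Arr C" "Dom C g = Cod C f" "Cod C g = Dom C f"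
    "g \<cdot> f = Ident C (Dom C f)" "f \<cdot> g = Ident C (Cod C f)"
  using assms unfolding isomorphism_def by auto

end

context abelian_category
begin

lemma rel_injective_extend:
  assumes "rel_injective C E (Cod C a)" "rel_monic C E f" "a \<in> Arr C" "Dom C a = Dom C f"
  obtains b where "b \<in> Arr C" "Dom C b = Cod C f" "Cod C b = Cod C a" "b \<cdot> f = a"
  using assms unfolding rel_injective_def by (metis in_Hom)

lemma rel_projective_lift:
  assumes "rel_projective C E (Dom C a)" "rel_epic C E f" "a \<in> Arr C" "Cod C a = Cod C f"
  obtains b where "b \<in> Arr C" "Dom C b = Dom C a" "Cod C b = Dom C f" "f \<cdot> b = a"
  using assms unfolding rel_projective_def by (metis in_Hom)

lemma rel_monic_arr: "rel_monic C E f \<Longrightarrow> f \<in> Arr C"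
  by (simp add: rel_monic_def monic_def)

lemma rel_epic_arr: "rel_epic C E f \<Longrightarrow> f \<in> Arr C"
  by (simp add: rel_epic_def epic_def)

lemma allowable_short_exact: "allowable_class C E \<Longrightarrow> (f, g) \<in> E \<Longrightarrow> short_exact C f g"
  unfolding allowable_class_def by blast

lemma short_exact_ident:
  assumes "zero_object C Z" "X \<in> Obj C"
  shows "short_exact C (Ident C X) (Zero C X Z)"
proof -
  have Z: "Z \<in> Obj C"
    using assms(1) by (simp add: zero_object_def)
  have "is_kernel C (Ident C X) (Zero C X Z)"
    unfolding is_kernel_def using assms Z by (auto intro!: ex1I)
  moreover have "is_cokernel C (Zero C X Z) (Ident C X)"
    unfolding is_cokernel_def
  proof (intro conjI ballI impI)
    fix h assume h: "h \<in> Arr C" "Dom C h = Cod C (Ident C X) \<and>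
      h \<cdot> Ident C X = Zero C (Dom C (Ident C X)) (Cod C h)"
    then have [simp]: "Dom C h = X"
      using assms by simp
    have h0: "h = Zero C X (Cod C h)"
      using h assms by simp
    show "\<exists>!u. u \<in> Hom C (Cod C (Zero C X Z)) (Cod C h) \<and> u \<cdot> Zero C X Z = h"
    proof (rule ex1I[of _ "Zero C Z (Cod C h)"])
      show "Zero C Z (Cod C h) \<in> Hom C (Cod C (Zero C X Z)) (Cod C h) \<and>
          Zero C Z (Cod C h) \<cdot> Zero C X Z = h"
        using h(1) h0[symmetric] assms Z by simp
    qed (use zero_object_arr_eq(1)[OF assms(1)] assms Z in auto)
  qed (use assms Z in simp_all)
  ultimately show ?thesis
    by (simp add: short_exact_def)
qed

lemma rel_monic_ident:
  assumes "allowable_class C E" "X \<in> Obj C"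
  shows "rel_monic C E (Ident C X)"
proof -
  obtain Z where Z: "zero_object C Z"
    using ex_zero_object by blast
  then have "Z \<in> Obj C"
    by (simp add: zero_object_def)
  then have "(Ident C X, Zero C X Z) \<in> E"
    using assms Z short_exact_ident[OF Z assms(2)] unfolding allowable_class_def
    by (metis zero_arr(3))
  then show ?thesis
    using short_exact_ident[OF Z assms(2)] kernel_monic
    unfolding rel_monic_def short_exact_def by blast
qed

text \<open>The definition of an \<open>E\<close>-monic provides only one cokernel with which it forms a sequence in \<open>E\<close>. Any
  other cokernel differs by an isomorphism, so closure of \<open>E\<close> under isomorphism covers it.\<close>

lemma rel_monic_cokernel:
  assumes "allowable_class C E" "rel_monic C E m" "is_cokernel C q m"
  shows "(m, q) \<in> E" "is_kernel C m q" "rel_epic C E q"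
proof -
  obtain c where c: "is_cokernel C c m" and mc: "(m, c) \<in> E"
    using assms(2) unfolding rel_monic_def by blast
  note cokernelD[OF c, simp] cokernelD[OF assms(3), simp]
  have kc: "is_kernel C m c"
    using allowable_short_exact[OF assms(1) mc] by (simp add: short_exact_def)
  obtain u where u [simp]: "u \<in> Arr C" "Dom C u = Cod C c" "Cod C u = Cod C q" and uc: "u \<cdot> c = q"
    using cokernel_factor[OF c, of q] by auto
  obtain v where v [simp]: "v \<in> Arr C" "Dom C v = Cod C q" "Cod C v = Cod C c" and vq: "v \<cdot> q = c"
    using cokernel_factor[OF assms(3), of c] by auto
  have vu: "v \<cdot> u = Ident C (Cod C c)"
    using epicD[OF cokernel_epic[OF c], of "v \<cdot> u" "Ident C (Cod C c)"] by (simp add: uc vq)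
  have uv: "u \<cdot> v = Ident C (Cod C q)"
    using epicD[OF cokernel_epic[OF assms(3)], of "u \<cdot> v" "Ident C (Cod C q)"]
    by (simp add: uc vq)
  have "isomorphism C u"
    unfolding isomorphism_def using vu uv by (auto intro!: bexI[of _ v])
  show kq: "is_kernel C m q"
    unfolding is_kernel_def
  proof (intro conjI ballI impI)
    fix h assume h: "h \<in> Arr C" "Cod C h = Dom C q \<and> q \<cdot> h = Zero C (Dom C h) (Cod C q)"
    have "v \<cdot> (q \<cdot> h) = c \<cdot> h"
      by (rule comp_eq_extend1[OF vq]) (use h in simp_all)
    then have "c \<cdot> h = Zero C (Dom C h) (Cod C c)"
      using h by simp
    then show "\<exists>!u. u \<in> Hom C (Dom C h) (Dom C m) \<and> m \<cdot> u = h"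
      using kc h unfolding is_kernel_def by simp
  qed simp_all
  have "ses_iso C (m, c) (m, q)"
    unfolding ses_iso_def short_exact_def prod.case
  proof (intro conjI exI)
    show "isomorphism C (Ident C (Dom C m))" "isomorphism C (Ident C (Cod C m))"
      by (simp_all add: isomorphism_ident)
  qed (use kc c kq assms(3) \<open>isomorphism C u\<close> uc in simp_all)
  then show "(m, q) \<in> E"
    using assms(1) mc unfolding allowable_class_def by blast
  then show "rel_epic C E q"
    using kq cokernel_epic[OF assms(3)] unfolding rel_epic_def by blast
qed

lemma rel_epic_kernel:
  assumes "allowable_class C E" "rel_epic C E q"
  obtains m where "is_kernel C m q" "is_cokernel C q m" "rel_monic C E m"
proof -
  obtain m where m: "is_kernel C m q" "(m, q) \<in> E"
    using assms(2) unfolding rel_epic_def by blast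
  then have "is_cokernel C q m"
    using allowable_short_exact[OF assms(1)] by (simp add: short_exact_def)
  then show ?thesis
    using that m kernel_monic[OF m(1)] unfolding rel_monic_def by blast
qed

end

locale injectively_detected_monics = abelian_category +
  fixes F
  assumes allowable_F: "allowable_class C F"
    and retractile_F: "retractile_monics C F"
    and enough_injectives_F: "enough_injectives C F"
begin

lemma rel_monic_right_factor:
  assumes "rel_monic C F (g \<cdot> f)" "f \<in> Arr C" "g \<in> Arr C" "Cod C f = Dom C g"
  shows "rel_monic C F f"
  using assms retractile_F unfolding retractile_monics_def by blast

text \<open>An \<open>F\<close>-monic from the domain of \<open>f\<close> into an \<open>F\<close>-injective object factors through \<open>f\<close> by assumption,
  so \<open>f\<close> is \<open>F\<close>-monic because \<open>F\<close> has retractile monics. Together with \<open>rel_injective_extend\<close> this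
  characterises \<open>F\<close>-monics by extension of maps, and all closure properties below are formal
  consequences.\<close>

lemma rel_monicI:
  assumes "f \<in> Arr C"
    and extend: "\<And>a. \<lbrakk>a \<in> Arr C; Dom C a = Dom C f; rel_injective C F (Cod C a)\<rbrakk> \<Longrightarrow>
      \<exists>b \<in> Arr C. Dom C b = Cod C f \<and> b \<cdot> f = a"
  shows "rel_monic C F f"
proof -
  obtain a where a: "rel_monic C F a" "Dom C a = Dom C f" "rel_injective C F (Cod C a)"
    using enough_injectives_F dom_obj[OF assms(1)] unfolding enough_injectives_def by blast
  then obtain b where "b \<in> Arr C" "Dom C b = Cod C f" "b \<cdot> f = a"
    using extend[of a] rel_monic_arr by blast
  then show ?thesis
    using a(1) assms(1) rel_monic_right_factor[of b f] by simp
qed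

lemma rel_monic_comp:
  assumes "rel_monic C F f" "rel_monic C F g" "Cod C f = Dom C g"
  shows "rel_monic C F (g \<cdot> f)"
proof (rule rel_monicI)
  note [simp] = rel_monic_arr[OF assms(1)] rel_monic_arr[OF assms(2)] assms(3)
  show "g \<cdot> f \<in> Arr C"
    by simp
  fix a assume a: "a \<in> Arr C" "Dom C a = Dom C (g \<cdot> f)" "rel_injective C F (Cod C a)"
  then obtain b where b: "b \<in> Arr C" "Dom C b = Cod C f" "Cod C b = Cod C a" "b \<cdot> f = a"
    using rel_injective_extend[OF a(3) assms(1)] by auto
  then obtain d where d: "d \<in> Arr C" "Dom C d = Cod C g" "Cod C d = Cod C b" "d \<cdot> g = b"
    using rel_injective_extend[of F b g] a assms by auto
  then have "d \<cdot> (g \<cdot> f) = a"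
    using b by (simp add: comp_eq_extend1[OF d(4)])
  then show "\<exists>b \<in> Arr C. Dom C b = Cod C (g \<cdot> f) \<and> b \<cdot> (g \<cdot> f) = a"
    using d by auto
qed

lemma rel_monic_from_zero:
  assumes "zero_object C (Dom C f)" "f \<in> Arr C"
  shows "rel_monic C F f"
proof (rule rel_monicI[OF assms(2)])
  fix a assume a: "a \<in> Arr C" "Dom C a = Dom C f"
  then have "Zero C (Cod C f) (Cod C a) \<cdot> f = a"
    using assms zero_object_arr_eq(1)[OF assms(1), of a] by simp
  then show "\<exists>b \<in> Arr C. Dom C b = Cod C f \<and> b \<cdot> f = a"
    using a assms by (auto intro!: bexI[of _ "Zero C (Cod C f) (Cod C a)"])
qed

lemma rel_monic_pushout:
  assumes "is_pushout C f g i j" "rel_monic C F g"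
  shows "rel_monic C F i"
proof (rule rel_monicI)
  note [simp] = pushoutD[OF assms(1)]
  show "i \<in> Arr C"
    by simp
  fix a assume a: "a \<in> Arr C" "Dom C a = Dom C i" "rel_injective C F (Cod C a)"
  then obtain b where b: "b \<in> Arr C" "Dom C b = Cod C g" "Cod C b = Cod C a" "b \<cdot> g = a \<cdot> f"
    using rel_injective_extend[of F "a \<cdot> f" g] assms(2) by auto
  then show "\<exists>b \<in> Arr C. Dom C b = Cod C i \<and> b \<cdot> i = a"
    using pushout_factor[OF assms(1), of a b] a by auto
qed

lemma left_inverse_rel_monic:
  assumes "r \<cdot> f = Ident C (Dom C f)" "f \<in> Arr C" "r \<in> Arr C" "Cod C f = Dom C r"
  shows "rel_monic C F f"
  using assms rel_monic_ident[OF allowable_F, of "Dom C f"] rel_monic_right_factor[of r f] by simp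

lemma isomorphism_rel_monic: "isomorphism C f \<Longrightarrow> rel_monic C F f"
  by (erule isomorphismE, erule left_inverse_rel_monic) simp_all

end


section \<open>Stable equivalences\<close>

context abelian_category
begin

text \<open>The maps that factor through a relative projective form a two-sided ideal; stable equivalence of maps is
  congruence modulo this ideal.\<close>

definition null
  where "null E f \<longleftrightarrow> (\<exists>a b. a \<in> Arr C \<and> b \<in> Arr C \<and> Cod C a = Dom C b \<and>
    rel_projective C E (Dom C b) \<and> f = b \<cdot> a)"

lemma null_arr: "null E f \<Longrightarrow> f \<in> Arr C"
  unfolding null_def by auto

lemma nullI:
  "a \<in> Arr C \<Longrightarrow> b \<in> Arr C \<Longrightarrow> Cod C a = Dom C b \<Longrightarrow> rel_projective C E (Dom C b) \<Longrightarrow> null E (b \<cdot> a)"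
  unfolding null_def by blast

lemma nullE:
  assumes "null E f"
  obtains a b where "a \<in> Arr C" "b \<in> Arr C" "Dom C a = Dom C f" "Cod C a = Dom C b"
    "Cod C b = Cod C f" "rel_projective C E (Dom C b)" "f = b \<cdot> a"
  using assms unfolding null_def by auto

lemma null_comp_left:
  assumes "null E f" "h \<in> Arr C" "Cod C f = Dom C h"
  shows "null E (h \<cdot> f)"
proof -
  obtain a b where "a \<in> Arr C" "b \<in> Arr C" "Dom C a = Dom C f" "Cod C a = Dom C b"
    "Cod C b = Cod C f" "rel_projective C E (Dom C b)" "f = b \<cdot> a"
    using nullE[OF assms(1)] by blast
  then show ?thesis
    using nullI[of a "h \<cdot> b" E] assms by simp
qed

lemma null_comp_right:
  assumes "null E f" "h \<in> Arr C" "Cod C h = Dom C f"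
  shows "null E (f \<cdot> h)"
proof -
  obtain a b where "a \<in> Arr C" "b \<in> Arr C" "Dom C a = Dom C f" "Cod C a = Dom C b"
    "Cod C b = Cod C f" "rel_projective C E (Dom C b)" "f = b \<cdot> a"
    using nullE[OF assms(1)] by blast
  then show ?thesis
    using nullI[of "a \<cdot> h" b E] assms by simp
qed

lemma null_neg:
  assumes "null E f"
  shows "null E (\<ominus> f)"
proof -
  obtain a b where "a \<in> Arr C" "b \<in> Arr C" "Dom C a = Dom C f" "Cod C a = Dom C b"
    "Cod C b = Cod C f" "rel_projective C E (Dom C b)" "f = b \<cdot> a"
    using nullE[OF assms(1)] by blast
  then show ?thesis
    using nullI[of a "\<ominus> b" E] by simp
qed

lemma rel_projective_biproduct:
  assumes "biproduct C P Q B i1 i2 p1 p2" "rel_projective C E P" "rel_projective C E Q"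
  shows "rel_projective C E B"
  unfolding rel_projective_def
proof (intro conjI allI impI ballI)
  interpret biproduct C P Q B i1 i2 p1 p2 by fact
  show "B \<in> Obj C"
    by simp
  fix f a assume f: "rel_epic C E f" and "a \<in> Hom C B (Cod C f)"
  note [simp] = rel_epic_arr[OF f]
  have a [simp]: "a \<in> Arr C" "Dom C a = B" "Cod C a = Cod C f"
    using \<open>a \<in> Hom C B (Cod C f)\<close> by simp_all
  obtain b1 where b1 [simp]: "b1 \<in> Arr C" "Dom C b1 = P" "Cod C b1 = Dom C f" "f \<cdot> b1 = a \<cdot> i1"
    using rel_projective_lift[of E "a \<cdot> i1" f] f assms(2) by auto
  obtain b2 where b2 [simp]: "b2 \<in> Arr C" "Dom C b2 = Q" "Cod C b2 = Dom C f" "f \<cdot> b2 = a \<cdot> i2"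
    using rel_projective_lift[of E "a \<cdot> i2" f] f assms(3) by auto
  have "f \<cdot> (b1 \<cdot> p1 \<oplus> b2 \<cdot> p2) = a"
    by (rule out_eqI) simp_all
  then show "\<exists>b \<in> Hom C B (Dom C f). f \<cdot> b = a"
    by (auto intro!: bexI[of _ "b1 \<cdot> p1 \<oplus> b2 \<cdot> p2"])
qed

lemma null_add:
  assumes "null E f" "null E g" "Dom C f = Dom C g" "Cod C f = Cod C g"
  shows "null E (f \<oplus> g)"
proof -
  obtain a b where f: "a \<in> Arr C" "b \<in> Arr C" "Dom C a = Dom C f" "Cod C a = Dom C b"
    "Cod C b = Cod C f" "rel_projective C E (Dom C b)" "f = b \<cdot> a"
    using nullE[OF assms(1)] by blast
  obtain a' b' where g: "a' \<in> Arr C" "b' \<in> Arr C" "Dom C a' = Dom C g" "Cod C a' = Dom C b'"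
    "Cod C b' = Cod C g" "rel_projective C E (Dom C b')" "g = b' \<cdot> a'"
    using nullE[OF assms(2)] by blast
  obtain B i1 i2 p1 p2 where B: "biproduct C (Dom C b) (Dom C b') B i1 i2 p1 p2"
    using obtain_biproduct[OF dom_obj[OF f(2)] dom_obj[OF g(2)]] by blast
  then interpret B: biproduct C "Dom C b" "Dom C b'" B i1 i2 p1 p2 .
  \<comment> \<open>The sum factors through the biproduct of the two projectives.\<close>
  have "f \<oplus> g = (b \<cdot> p1 \<oplus> b' \<cdot> p2) \<cdot> (i1 \<cdot> a \<oplus> i2 \<cdot> a')"
    using f(1-5) g(1-5) assms(3,4) by (simp add: f(7) g(7))
  also have "null E \<dots>"
    using f(1-5) g(1-5) assms(3,4) rel_projective_biproduct[OF B f(6) g(6)]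
    by (intro nullI) simp_all
  finally show ?thesis .
qed

text \<open>If the identity of \<open>X\<close> factors through a projective object, then \<open>X\<close> is a retract of it.\<close>

lemma rel_projective_if_null_ident:
  assumes "null E (Ident C X)" "X \<in> Obj C"
  shows "rel_projective C E X"
  unfolding rel_projective_def
proof (intro conjI allI impI ballI)
  obtain a b where ab: "a \<in> Arr C" "b \<in> Arr C" "Dom C a = X" "Cod C a = Dom C b"
    "Cod C b = X" "rel_projective C E (Dom C b)" "b \<cdot> a = Ident C X"
    using nullE[OF assms(1)] assms(2) by (metis ident_arr(2,3))
  fix f t assume f: "rel_epic C E f" and t: "t \<in> Hom C X (Cod C f)"
  then obtain l where l: "l \<in> Arr C" "Dom C l = Dom C b" "Cod C l = Dom C f" "f \<cdot> l = t \<cdot> b"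
    using rel_projective_lift[of E "t \<cdot> b" f] ab by auto
  have "f \<cdot> (l \<cdot> a) = (t \<cdot> b) \<cdot> a"
    by (rule comp_eq_extend1[OF l(4)]) (use rel_epic_arr[OF f] ab(1-5) l(1-3) in simp_all)
  also have "\<dots> = t"
    using ab t by simp
  finally show "\<exists>b \<in> Hom C X (Dom C f). f \<cdot> b = t"
    using ab l rel_epic_arr[OF f] by (auto intro!: bexI[of _ "l \<cdot> a"])
qed (rule assms(2))

lemma stably_equivalent_iff:
  "stably_equivalent C E f g \<longleftrightarrow> f \<in> Arr C \<and> g \<in> Arr C \<and> Dom C g = Dom C f \<and> Cod C g = Cod C f \<and>
    null E (f \<oplus> \<ominus> g)"
proof (cases "f \<in> Arr C \<and> g \<in> Arr C \<and> Dom C g = Dom C f \<and> Cod C g = Cod C f")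
  case True
  then have "hom_diff C (Dom C f) (Cod C f) f g = f \<oplus> \<ominus> g"
    using hom_diff_eq[of g "Dom C f" "Cod C f" f] by simp
  moreover have "(\<exists>P a b. rel_projective C E P \<and> a \<in> Hom C (Dom C f) P \<and> b \<in> Hom C P (Cod C f) \<and>
      f \<oplus> \<ominus> g = b \<cdot> a) \<longleftrightarrow> null E (f \<oplus> \<ominus> g)" (is "?L \<longleftrightarrow> ?R")
  proof
    show "?R" if "?L"
      using that nullI[of _ _ E] by auto
    show "?L" if "?R"
    proof -
      have ends: "Dom C (f \<oplus> \<ominus> g) = Dom C f" "Cod C (f \<oplus> \<ominus> g) = Cod C f"
        using True by simp_all
      obtain a b where "a \<in> Arr C" "b \<in> Arr C" "Dom C a = Dom C f" "Cod C a = Dom C b"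
        "Cod C b = Cod C f" "rel_projective C E (Dom C b)" "f \<oplus> \<ominus> g = b \<cdot> a"
        using nullE[OF \<open>?R\<close>] unfolding ends .
      then have "rel_projective C E (Dom C b) \<and> a \<in> Hom C (Dom C f) (Dom C b) \<and>
          b \<in> Hom C (Dom C b) (Cod C f) \<and> f \<oplus> \<ominus> g = b \<cdot> a"
        using True by simp
      then show ?thesis
        by blast
    qed
  qed
  ultimately show ?thesis
    using True by (simp add: stably_equivalent_def)
qed (auto simp: stably_equivalent_def)

end

locale stable_class = abelian_category +
  fixes E
  assumes allowable_E: "allowable_class C E"
    and retractile_E: "retractile_monics C E"
    and enough_projectives_E: "enough_projectives C E"
    and projective_injective: "rel_projective C E X \<Longrightarrow> rel_injective C E X"
begin

abbreviation stably (infix "\<simeq>" 50)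
  where "f \<simeq> g \<equiv> stably_equivalent C E f g"

lemma stablyD:
  assumes "f \<simeq> g"
  shows "f \<in> Arr C" "g \<in> Arr C" "Dom C f = Dom C g" "Cod C f = Cod C g"
  using assms by (simp_all add: stably_equivalent_iff)

lemma obtain_projective_cover:
  assumes "W \<in> Obj C"
  obtains q k where "rel_projective C E (Dom C q)" "Cod C q = W" "rel_epic C E q"
    "is_kernel C k q" "is_cokernel C q k" "rel_monic C E k"
proof -
  obtain q where "rel_epic C E q" "Cod C q = W" "rel_projective C E (Dom C q)"
    using enough_projectives_E assms unfolding enough_projectives_def by blast
  then show ?thesis
    using that rel_epic_kernel[OF allowable_E] by metis
qed

lemma null_zero:
  assumes "X \<in> Obj C" "Y \<in> Obj C"
  shows "null E (Zero C X Y)"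
proof -
  obtain q k where q: "rel_projective C E (Dom C q)" "Cod C q = Y" "rel_epic C E q"
    "is_kernel C k q" "is_cokernel C q k" "rel_monic C E k"
    using obtain_projective_cover[OF assms(2)] .
  have "null E (q \<cdot> Zero C X (Dom C q))"
    using q rel_epic_arr[OF q(3)] assms by (intro nullI) simp_all
  then show ?thesis
    using q(2) rel_epic_arr[OF q(3)] assms by simp
qed

lemma stably_refl: "f \<in> Arr C \<Longrightarrow> f \<simeq> f"
  using null_zero[of "Dom C f" "Cod C f"] by (simp add: stably_equivalent_iff)

lemma stably_sym:
  assumes "f \<simeq> g"
  shows "g \<simeq> f"
proof -
  have "null E (\<ominus> (f \<oplus> \<ominus> g))"
    using assms by (intro null_neg) (simp add: stably_equivalent_iff)
  then show ?thesis
    using stablyD[OF assms] by (simp add: stably_equivalent_iff add_commute)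
qed

lemma stably_trans [trans]:
  assumes "f \<simeq> g" "g \<simeq> h"
  shows "f \<simeq> h"
proof -
  note [simp] = stablyD[OF assms(1)] stablyD[OF assms(2)]
  have "null E ((f \<oplus> \<ominus> g) \<oplus> (g \<oplus> \<ominus> h))"
    by (rule null_add) (use assms in \<open>simp_all add: stably_equivalent_iff\<close>)
  then show ?thesis
    by (simp add: stably_equivalent_iff add_assoc)
qed

lemma stably_comp_left:
  assumes "f \<simeq> g" "h \<in> Arr C" "Cod C f = Dom C h"
  shows "h \<cdot> f \<simeq> h \<cdot> g"
  using null_comp_left[of E "f \<oplus> \<ominus> g" h] assms stablyD[OF assms(1)]
  by (simp add: stably_equivalent_iff)

lemma stably_comp_right:
  assumes "f \<simeq> g" "h \<in> Arr C" "Cod C h = Dom C f"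
  shows "f \<cdot> h \<simeq> g \<cdot> h"
  using null_comp_right[of E "f \<oplus> \<ominus> g" h] assms stablyD[OF assms(1)]
  by (simp add: stably_equivalent_iff)

lemma stably_add:
  assumes "f \<simeq> g" "f' \<simeq> g'" "Dom C f = Dom C f'" "Cod C f = Cod C f'"
  shows "f \<oplus> f' \<simeq> g \<oplus> g'"
proof -
  note [simp] = stablyD[OF assms(1)] stablyD[OF assms(2)]
  have [simp]: "Dom C g = Dom C g'" "Cod C g = Cod C g'"
    using assms(3,4) by simp_all
  have "null E ((f \<oplus> \<ominus> g) \<oplus> (f' \<oplus> \<ominus> g'))"
    by (rule null_add) (use assms in \<open>simp_all add: stably_equivalent_iff\<close>)
  then show ?thesis
    by (simp add: stably_equivalent_iff add_assoc add_left_commute[of "\<ominus> g" f'])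
qed

lemma stably_neg: "f \<simeq> g \<Longrightarrow> \<ominus> f \<simeq> \<ominus> g"
  using null_neg[of E "f \<oplus> \<ominus> g"] by (simp add: stably_equivalent_iff)

lemma stably_null:
  assumes "f \<simeq> g" "null E g"
  shows "null E f"
  using null_add[of E "f \<oplus> \<ominus> g" g] assms stablyD[OF assms(1)]
  by (simp add: stably_equivalent_iff)

lemma stably_add_null:
  assumes "null E g" "f \<in> Arr C" "Dom C f = Dom C g" "Cod C f = Cod C g"
  shows "f \<oplus> g \<simeq> f"
  using assms null_arr[OF assms(1)]
  by (simp add: stably_equivalent_iff add_commute[of f g] add_assoc)

text \<open>This is the place where projectives have to be injective: a map through a projective object \<open>P\<close>
  extends along an \<open>E\<close>-monic because its first factor, a map to \<open>P\<close>, does.\<close>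

lemma null_extend:
  assumes "null E r" "rel_monic C E k" "Dom C r = Dom C k"
  obtains r' where "r' \<in> Arr C" "Dom C r' = Cod C k" "Cod C r' = Cod C r" "r' \<cdot> k = r"
proof -
  obtain a b where ab: "a \<in> Arr C" "b \<in> Arr C" "Dom C a = Dom C r" "Cod C a = Dom C b"
    "Cod C b = Cod C r" "rel_projective C E (Dom C b)" "r = b \<cdot> a"
    using nullE[OF assms(1)] by blast
  then obtain l where "l \<in> Arr C" "Dom C l = Cod C k" "Cod C l = Dom C b" "l \<cdot> k = a"
    using rel_injective_extend[of E a k] projective_injective assms by auto
  moreover from this have "(b \<cdot> l) \<cdot> k = b \<cdot> a"
    using ab(1-5) assms(3) rel_monic_arr[OF assms(2)] by simp
  ultimately show ?thesis
    using that[of "b \<cdot> l"] ab(1-5) rel_monic_arr[OF assms(2)] unfolding ab(7)[symmetric] by simp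
qed

lemma null_lift:
  assumes "null E t" "rel_epic C E q" "Cod C t = Cod C q"
  obtains v where "null E v" "Dom C v = Dom C t" "Cod C v = Dom C q" "q \<cdot> v = t"
proof -
  obtain a b where ab: "a \<in> Arr C" "b \<in> Arr C" "Dom C a = Dom C t" "Cod C a = Dom C b"
    "Cod C b = Cod C t" "rel_projective C E (Dom C b)" "t = b \<cdot> a"
    using nullE[OF assms(1)] by blast
  then obtain l where l: "l \<in> Arr C" "Dom C l = Dom C b" "Cod C l = Dom C q" "q \<cdot> l = b"
    using rel_projective_lift[of E b q] assms by auto
  have "q \<cdot> (l \<cdot> a) = b \<cdot> a"
    by (rule comp_eq_extend1[OF l(4)]) (use l(1-3) ab(1-5) rel_epic_arr[OF assms(2)] in simp_all)
  then show ?thesis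
    using that[of "l \<cdot> a"] ab(1-6) l(1-3) nullI[of a l E] unfolding ab(7)[symmetric] by simp
qed

lemma stable_equivalence_arr: "stable_equivalence C E f \<Longrightarrow> f \<in> Arr C"
  by (simp add: stable_equivalence_def)

lemma stable_equivalenceE:
  assumes "stable_equivalence C E f"
  obtains h where "f \<in> Arr C" "h \<in> Arr C" "Dom C h = Cod C f" "Cod C h = Dom C f"
    "f \<cdot> h \<simeq> Ident C (Cod C f)" "h \<cdot> f \<simeq> Ident C (Dom C f)"
  using assms unfolding stable_equivalence_def by auto

lemma stable_equivalence_inverseI:
  assumes "f \<cdot> h \<simeq> Ident C (Cod C f)" "h \<cdot> f \<simeq> Ident C (Dom C f)" "f \<in> Arr C" "h \<in> Arr C"
    "Dom C h = Cod C f" "Cod C h = Dom C f"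
  shows "stable_equivalence C E f"
  using assms unfolding stable_equivalence_def by auto

text \<open>The next three lemmas are the Yoneda lemma for the stable category: \<open>u\<close> is a stable equivalence if
  and only if composition with \<open>u\<close> is bijective on stable classes of maps. Surjectivity for the identity
  of the codomain yields a right inverse, and injectivity makes it a left inverse.\<close>

lemma stable_equivalence_surj:
  assumes "stable_equivalence C E u" "t \<in> Arr C" "Cod C t = Cod C u"
  obtains s where "s \<in> Arr C" "Dom C s = Dom C t" "Cod C s = Dom C u" "u \<cdot> s \<simeq> t"
proof -
  obtain h where h: "u \<in> Arr C" "h \<in> Arr C" "Dom C h = Cod C u" "Cod C h = Dom C u"
    "u \<cdot> h \<simeq> Ident C (Cod C u)"
    using stable_equivalenceE[OF assms(1)] by blast
  have "(u \<cdot> h) \<cdot> t \<simeq> Ident C (Cod C u) \<cdot> t"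
    using h assms(2,3) by (intro stably_comp_right) simp_all
  then show ?thesis
    using that[of "h \<cdot> t"] h assms(2,3) by simp
qed

lemma stable_equivalence_inj:
  assumes "stable_equivalence C E u" "null E (u \<cdot> t)" "t \<in> Arr C" "Cod C t = Dom C u"
  shows "null E t"
proof -
  obtain h where h: "u \<in> Arr C" "h \<in> Arr C" "Dom C h = Cod C u" "Cod C h = Dom C u"
    "h \<cdot> u \<simeq> Ident C (Dom C u)"
    using stable_equivalenceE[OF assms(1)] by blast
  have "(h \<cdot> u) \<cdot> t \<simeq> Ident C (Dom C u) \<cdot> t"
    using h assms(3,4) by (intro stably_comp_right) simp_all
  then have "h \<cdot> (u \<cdot> t) \<simeq> t"
    using h assms(3,4) by simp
  from stably_sym[OF this] show ?thesis
    using null_comp_left[OF assms(2), of h] h assms(3,4) stably_null by simp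
qed

lemma stable_equivalenceI:
  assumes u: "u \<in> Arr C"
    and surj: "\<And>t. t \<in> Arr C \<Longrightarrow> Cod C t = Cod C u \<Longrightarrow>
      \<exists>s \<in> Arr C. Dom C s = Dom C t \<and> Cod C s = Dom C u \<and> u \<cdot> s \<simeq> t"
    and inj: "\<And>t. t \<in> Arr C \<Longrightarrow> Cod C t = Dom C u \<Longrightarrow> null E (u \<cdot> t) \<Longrightarrow> null E t"
  shows "stable_equivalence C E u"
proof -
  obtain h where h [simp]: "h \<in> Arr C" "Dom C h = Cod C u" "Cod C h = Dom C u"
    and uh: "u \<cdot> h \<simeq> Ident C (Cod C u)"
    using surj[of "Ident C (Cod C u)"] u by auto
  have "(u \<cdot> h) \<cdot> u \<simeq> Ident C (Cod C u) \<cdot> u"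
    using uh u by (intro stably_comp_right) simp_all
  then have "null E (u \<cdot> (h \<cdot> u \<oplus> \<ominus> (Ident C (Dom C u))))"
    using u by (simp add: stably_equivalent_iff)
  then have "null E (h \<cdot> u \<oplus> \<ominus> (Ident C (Dom C u)))"
    using u inj[of "h \<cdot> u \<oplus> \<ominus> (Ident C (Dom C u))"] by simp
  then have "h \<cdot> u \<simeq> Ident C (Dom C u)"
    using u by (simp add: stably_equivalent_iff)
  with uh show ?thesis
    using u by (intro stable_equivalence_inverseI[of u h]) simp_all
qed

lemma stable_equivalence_comp:
  assumes "stable_equivalence C E f" "stable_equivalence C E g" "Cod C f = Dom C g"
  shows "stable_equivalence C E (g \<cdot> f)"
proof (rule stable_equivalenceI)
  note [simp] = stable_equivalence_arr[OF assms(1)] stable_equivalence_arr[OF assms(2)] assms(3)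
  show "g \<cdot> f \<in> Arr C"
    by simp
  fix t assume t: "t \<in> Arr C"
  show "\<exists>s \<in> Arr C. Dom C s = Dom C t \<and> Cod C s = Dom C (g \<cdot> f) \<and> (g \<cdot> f) \<cdot> s \<simeq> t"
    if "Cod C t = Cod C (g \<cdot> f)"
  proof -
    from that have "Cod C t = Cod C g"
      by simp
    then obtain s where s [simp]: "s \<in> Arr C" "Dom C s = Dom C t" "Cod C s = Dom C g" "g \<cdot> s \<simeq> t"
      using stable_equivalence_surj[OF assms(2) t] by blast
    obtain r where r [simp]: "r \<in> Arr C" "Dom C r = Dom C s" "Cod C r = Dom C f" "f \<cdot> r \<simeq> s"
      using stable_equivalence_surj[OF assms(1) s(1)] by auto
    have "g \<cdot> (f \<cdot> r) \<simeq> g \<cdot> s"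
      by (intro stably_comp_left) simp_all
    also note s(4)
    finally show ?thesis
      by (intro bexI[of _ r]) simp_all
  qed
  show "null E t" if "Cod C t = Dom C (g \<cdot> f)" "null E ((g \<cdot> f) \<cdot> t)"
    using that t stable_equivalence_inj[OF assms(2), of "f \<cdot> t"]
      stable_equivalence_inj[OF assms(1), of t] by simp
qed

lemma isomorphism_stable_equivalence:
  assumes "isomorphism C f"
  shows "stable_equivalence C E f"
proof -
  obtain g where "f \<in> Arr C" "g \<in> Arr C" "Dom C g = Cod C f" "Cod C g = Dom C f"
    "g \<cdot> f = Ident C (Dom C f)" "f \<cdot> g = Ident C (Cod C f)"
    using isomorphismE[OF assms] .
  then show ?thesis
    by (intro stable_equivalence_inverseI[of f g]) (simp_all add: stably_refl)
qed

lemma stable_equivalence_biproduct: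
  assumes "biproduct C Y Z B i1 i2 p1 p2" "biproduct C Y' Z' B' i1' i2' p1' p2'"
    "stable_equivalence C E b" "stable_equivalence C E c"
    "Dom C b = Y" "Cod C b = Y'" "Dom C c = Z" "Cod C c = Z'"
  shows "stable_equivalence C E (i1' \<cdot> b \<cdot> p1 \<oplus> i2' \<cdot> c \<cdot> p2)" (is "stable_equivalence C E ?u")
proof (rule stable_equivalenceI)
  interpret B: biproduct C Y Z B i1 i2 p1 p2 by fact
  interpret B': biproduct C Y' Z' B' i1' i2' p1' p2' by fact
  note [simp] = stable_equivalence_arr[OF assms(3)] stable_equivalence_arr[OF assms(4)] assms(5-8)
  show "?u \<in> Arr C"
    by simp
  fix t assume t [simp]: "t \<in> Arr C"
  show "\<exists>s \<in> Arr C. Dom C s = Dom C t \<and> Cod C s = Dom C ?u \<and> ?u \<cdot> s \<simeq> t"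
    if "Cod C t = Cod C ?u"
  proof -
    from that have [simp]: "Cod C t = B'"
      by simp
    obtain r where r [simp]: "r \<in> Arr C" "Dom C r = Dom C t" "Cod C r = Y" "b \<cdot> r \<simeq> p1' \<cdot> t"
      using stable_equivalence_surj[OF assms(3), of "p1' \<cdot> t"] by auto
    obtain s where s [simp]: "s \<in> Arr C" "Dom C s = Dom C t" "Cod C s = Z" "c \<cdot> s \<simeq> p2' \<cdot> t"
      using stable_equivalence_surj[OF assms(4), of "p2' \<cdot> t"] by auto
    have "?u \<cdot> (i1 \<cdot> r \<oplus> i2 \<cdot> s) = i1' \<cdot> (b \<cdot> r) \<oplus> i2' \<cdot> (c \<cdot> s)"
      by simp
    also have "\<dots> \<simeq> i1' \<cdot> (p1' \<cdot> t) \<oplus> i2' \<cdot> (p2' \<cdot> t)"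
      by (intro stably_add stably_comp_left) simp_all
    also have "\<dots> = t"
      by (simp add: B'.biproduct_sum_comp)
    finally show ?thesis
      by (intro bexI[of _ "i1 \<cdot> r \<oplus> i2 \<cdot> s"]) simp_all
  qed
  show "null E t" if "Cod C t = Dom C ?u" "null E (?u \<cdot> t)"
  proof -
    from that(1) have [simp]: "Cod C t = B"
      by simp
    have "null E (b \<cdot> (p1 \<cdot> t))" "null E (c \<cdot> (p2 \<cdot> t))"
      using null_comp_left[OF that(2), of p1'] null_comp_left[OF that(2), of p2'] by simp_all
    then have "null E (p1 \<cdot> t)" "null E (p2 \<cdot> t)"
      using stable_equivalence_inj[OF assms(3), of "p1 \<cdot> t"]
        stable_equivalence_inj[OF assms(4), of "p2 \<cdot> t"] by simp_all
    then have "null E (i1 \<cdot> (p1 \<cdot> t) \<oplus> i2 \<cdot> (p2 \<cdot> t))"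
      by (intro null_add null_comp_left[of _ "p1 \<cdot> t"] null_comp_left[of _ "p2 \<cdot> t"]) simp_all
    then show ?thesis
      by (simp add: B.biproduct_sum_comp)
  qed
qed


text \<open>The five lemma for the exact sequence \<open>[W, X] \<rightarrow> [W, Y] \<rightarrow> [W, Z] \<rightarrow> [K, X] \<rightarrow> [K, Y]\<close> attached to a
  sequence \<open>X \<rightarrow> Y \<rightarrow> Z\<close> in \<open>E\<close>, by a chase with representatives. Here \<open>k : K \<rightarrow> Q\<close> is the kernel of an
  \<open>E\<close>-epic \<open>p : Q \<rightarrow> W\<close> from an \<open>E\<close>-projective object. The connecting map sends \<open>t : W \<rightarrow> Z\<close> to the
  map \<open>r : K \<rightarrow> X\<close> induced by a lift \<open>s : Q \<rightarrow> Y\<close> of \<open>t \<cdot> p\<close>.\<close>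

lemma stable_equivalence_cokernel:
  assumes f: "rel_monic C E f" "is_cokernel C q f" and f': "rel_monic C E f'" "is_cokernel C q' f'"
    and a: "stable_equivalence C E a" "Dom C a = Dom C f" "Cod C a = Dom C f'"
    and b: "stable_equivalence C E b" "Dom C b = Cod C f" "Cod C b = Cod C f'"
    and u: "u \<in> Arr C" "Dom C u = Cod C q" "Cod C u = Cod C q'"
    and squares: "b \<cdot> f = f' \<cdot> a" "q' \<cdot> b = u \<cdot> q"
  shows "stable_equivalence C E u"
proof (rule stable_equivalenceI)
  note ker = rel_monic_cokernel(2)[OF allowable_E f] and ker' = rel_monic_cokernel(2)[OF allowable_E f']
  note epi = rel_monic_cokernel(3)[OF allowable_E f] and epi' = rel_monic_cokernel(3)[OF allowable_E f']
  note [simp] = cokernelD[OF f(2)] cokernelD[OF f'(2)] a(2,3) b(2,3) u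
    stable_equivalence_arr[OF a(1)] stable_equivalence_arr[OF b(1)]
    squares comp_eq_extend[OF squares(1)] comp_eq_extend[OF squares(2)]
    comp_eq_extend1[OF cokernelD(4)[OF f(2)]] comp_eq_extend1[OF cokernelD(4)[OF f'(2)]]
  show "u \<in> Arr C"
    by simp
  fix t assume [simp]: "t \<in> Arr C"
  obtain p k where proj: "rel_projective C E (Dom C p)" and [simp]: "Cod C p = Dom C t"
    and p: "rel_epic C E p" "is_kernel C k p" "is_cokernel C p k" "rel_monic C E k"
    using obtain_projective_cover[of "Dom C t"] by auto
  note [simp] = kernelD[OF p(2)] comp_eq_extend1[OF kernelD(4)[OF p(2)]]
  have null_k: "null E (h \<cdot> k)" if "h \<in> Arr C" "Dom C h = Dom C p" for h
    using that proj by (intro nullI) simp_all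
  show "null E t" if ut: "Cod C t = Dom C u" "null E (u \<cdot> t)"
  proof -
    from ut(1) have [simp]: "Cod C t = Cod C q"
      by simp
    \<comment> \<open>Injectivity. The map \<open>r\<close> is the image of \<open>t\<close> under the connecting map.\<close>
    obtain s where [simp]: "s \<in> Arr C" "Dom C s = Dom C p" "Cod C s = Cod C f" and qs: "q \<cdot> s = t \<cdot> p"
      using rel_projective_lift[of E "t \<cdot> p" q] proj epi by auto
    note [simp] = qs comp_eq_extend[OF qs]
    obtain r where [simp]: "r \<in> Arr C" "Dom C r = Dom C k" "Cod C r = Dom C f" and fr: "f \<cdot> r = s \<cdot> k"
      using kernel_factor[OF ker, of "s \<cdot> k"] by auto
    \<comment> \<open>As \<open>u \<cdot> t\<close> is null, it lifts to a null map \<open>v\<close>. The lifts \<open>b \<cdot> s\<close> and \<open>v \<cdot> p\<close> of the same map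
      differ by a map \<open>w\<close> into the kernel, which exhibits \<open>a \<cdot> r\<close> as a map that extends to the
      projective object \<open>Q\<close>.\<close>
    obtain v where v: "null E v" "Dom C v = Dom C t" "Cod C v = Cod C f'" "q' \<cdot> v = u \<cdot> t"
      using null_lift[OF ut(2) epi'] by auto
    note [simp] = null_arr[OF v(1)] v(2-4) comp_eq_extend[OF v(4)]
    obtain w where [simp]: "w \<in> Arr C" "Dom C w = Dom C p" "Cod C w = Dom C f'"
      and fw: "f' \<cdot> w = b \<cdot> s \<oplus> \<ominus> (v \<cdot> p)"
      using kernel_factor[OF ker', of "b \<cdot> s \<oplus> \<ominus> (v \<cdot> p)"] by auto
    have "f' \<cdot> (w \<cdot> k) = (b \<cdot> s \<oplus> \<ominus> (v \<cdot> p)) \<cdot> k"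
      by (rule comp_eq_extend1[OF fw]) simp_all
    also have "\<dots> = f' \<cdot> (a \<cdot> r)"
      by (simp add: fr[symmetric])
    finally have "w \<cdot> k = a \<cdot> r"
      by (rule monicD[OF kernel_monic[OF ker']]) simp_all
    then have "null E r"
      using stable_equivalence_inj[OF a(1), of r] null_k[of w] by simp
    \<comment> \<open>An extension \<open>r'\<close> of \<open>r\<close> corrects the lift \<open>s\<close> so that it descends to a lift \<open>t'\<close> of \<open>t\<close> itself.\<close>
    then obtain r' where [simp]: "r' \<in> Arr C" "Dom C r' = Dom C p" "Cod C r' = Dom C f" "r' \<cdot> k = r"
      using null_extend[OF _ p(4), of r] by auto
    obtain t' where [simp]: "t' \<in> Arr C" "Dom C t' = Dom C t" "Cod C t' = Cod C f"
      and tp: "t' \<cdot> p = s \<oplus> \<ominus> (f \<cdot> r')"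
      using cokernel_factor[OF p(3), of "s \<oplus> \<ominus> (f \<cdot> r')"] by (auto simp: fr)
    have "(q \<cdot> t') \<cdot> p = t \<cdot> p"
      by (simp add: tp)
    then have qt: "q \<cdot> t' = t"
      by (rule epicD[OF cokernel_epic[OF p(3)]]) simp_all
    note [simp] = qt comp_eq_extend1[OF qt]
    \<comment> \<open>Now \<open>b \<cdot> t'\<close> becomes null in \<open>[W, Z']\<close>, so up to a null map it comes from \<open>m : W \<rightarrow> X'\<close>, and then
      \<open>t'\<close> comes from a preimage \<open>n\<close> of \<open>m\<close>; hence \<open>t = q \<cdot> t'\<close> is null.\<close>
    obtain m where [simp]: "m \<in> Arr C" "Dom C m = Dom C t" "Cod C m = Dom C f'"
      and fm: "f' \<cdot> m = b \<cdot> t' \<oplus> \<ominus> v"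
      using kernel_factor[OF ker', of "b \<cdot> t' \<oplus> \<ominus> v"] by auto
    obtain n where [simp]: "n \<in> Arr C" "Dom C n = Dom C t" "Cod C n = Dom C f" and an: "a \<cdot> n \<simeq> m"
      using stable_equivalence_surj[OF a(1), of m] by auto
    have "b \<cdot> t' \<oplus> \<ominus> (f' \<cdot> (a \<cdot> n)) \<simeq> b \<cdot> t' \<oplus> \<ominus> (f' \<cdot> m)"
      using an by (intro stably_add stably_refl stably_neg stably_comp_left) simp_all
    also have "b \<cdot> t' \<oplus> \<ominus> (f' \<cdot> m) = v"
      by (simp add: fm)
    finally have "null E (b \<cdot> (t' \<oplus> \<ominus> (f \<cdot> n)))"
      using stably_null v(1) by simp
    then have "null E (t' \<oplus> \<ominus> (f \<cdot> n))"
      using stable_equivalence_inj[OF b(1), of "t' \<oplus> \<ominus> (f \<cdot> n)"] by simp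
    then have "null E (q \<cdot> (t' \<oplus> \<ominus> (f \<cdot> n)))"
      by (rule null_comp_left) simp_all
    then show ?thesis
      by simp
  qed
  show "\<exists>s \<in> Arr C. Dom C s = Dom C t \<and> Cod C s = Dom C u \<and> u \<cdot> s \<simeq> t" if ut: "Cod C t = Cod C u"
  proof -
    from ut have [simp]: "Cod C t = Cod C q'"
      by simp
    \<comment> \<open>Surjectivity. The map \<open>r\<close> is the image of \<open>t\<close> under the connecting map, and \<open>r1\<close> is a stable
      preimage of \<open>r\<close> under \<open>a\<close>.\<close>
    obtain s where [simp]: "s \<in> Arr C" "Dom C s = Dom C p" "Cod C s = Cod C f'"
      and qs: "q' \<cdot> s = t \<cdot> p"
      using rel_projective_lift[of E "t \<cdot> p" q'] proj epi' by auto
    note [simp] = qs comp_eq_extend[OF qs]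
    obtain r where [simp]: "r \<in> Arr C" "Dom C r = Dom C k" "Cod C r = Dom C f'"
      and fr: "f' \<cdot> r = s \<cdot> k"
      using kernel_factor[OF ker', of "s \<cdot> k"] by auto
    obtain r1 where [simp]: "r1 \<in> Arr C" "Dom C r1 = Dom C k" "Cod C r1 = Dom C f"
      and ar: "a \<cdot> r1 \<simeq> r"
      using stable_equivalence_surj[OF a(1), of r] by auto
    \<comment> \<open>As \<open>f' \<cdot> r\<close> extends to \<open>Q\<close>, the image of \<open>r1\<close> in \<open>[K, Y]\<close> vanishes, so \<open>r1\<close> is the image of some
      \<open>t1 : W \<rightarrow> Z\<close> under the connecting map.\<close>
    have "f' \<cdot> (a \<cdot> r1) \<simeq> f' \<cdot> r"
      using ar by (rule stably_comp_left) simp_all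
    then have "null E (b \<cdot> (f \<cdot> r1))"
      using stably_null null_k[of s] by (simp add: fr)
    then have "null E (f \<cdot> r1)"
      using stable_equivalence_inj[OF b(1), of "f \<cdot> r1"] by simp
    then obtain s1 where [simp]: "s1 \<in> Arr C" "Dom C s1 = Dom C p" "Cod C s1 = Cod C f"
      and sk: "s1 \<cdot> k = f \<cdot> r1"
      using null_extend[OF _ p(4), of "f \<cdot> r1"] by auto
    obtain t1 where [simp]: "t1 \<in> Arr C" "Dom C t1 = Dom C t" "Cod C t1 = Cod C q"
      and tp: "t1 \<cdot> p = q \<cdot> s1"
      using cokernel_factor[OF p(3), of "q \<cdot> s1"] by (auto simp: sk)
    have "null E (a \<cdot> r1 \<oplus> \<ominus> r)"
      using ar by (simp add: stably_equivalent_iff)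
    then obtain m where [simp]: "m \<in> Arr C" "Dom C m = Dom C p" "Cod C m = Dom C f'"
      and mk: "m \<cdot> k = a \<cdot> r1 \<oplus> \<ominus> r"
      using null_extend[OF _ p(4), of "a \<cdot> r1 \<oplus> \<ominus> r"] by auto
    \<comment> \<open>The maps \<open>t\<close> and \<open>u \<cdot> t1\<close> have the same image in \<open>[K, X']\<close>. The difference of their lifts, corrected by
      \<open>f' \<cdot> m\<close>, descends to \<open>l : W \<rightarrow> Y'\<close>, so that \<open>t\<close> and \<open>u \<cdot> t1\<close> differ by \<open>q' \<cdot> l\<close>, and \<open>l\<close>
      has a stable preimage \<open>l1\<close> under \<open>b\<close>.\<close>
    have "(s \<oplus> \<ominus> (b \<cdot> s1) \<oplus> f' \<cdot> m) \<cdot> k = Zero C (Dom C k) (Cod C f')"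
      by (simp add: sk mk fr[symmetric] add_ac)
    then obtain l where [simp]: "l \<in> Arr C" "Dom C l = Dom C t" "Cod C l = Cod C f'"
      and lp: "l \<cdot> p = s \<oplus> \<ominus> (b \<cdot> s1) \<oplus> f' \<cdot> m"
      using cokernel_factor[OF p(3), of "s \<oplus> \<ominus> (b \<cdot> s1) \<oplus> f' \<cdot> m"] by auto
    have "(q' \<cdot> l) \<cdot> p = (t \<oplus> \<ominus> (u \<cdot> t1)) \<cdot> p"
      by (simp add: lp tp)
    then have ql: "q' \<cdot> l = t \<oplus> \<ominus> (u \<cdot> t1)"
      by (rule epicD[OF cokernel_epic[OF p(3)]]) simp_all
    obtain l1 where [simp]: "l1 \<in> Arr C" "Dom C l1 = Dom C t" "Cod C l1 = Cod C f"
      and bl: "b \<cdot> l1 \<simeq> l"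
      using stable_equivalence_surj[OF b(1), of l] by auto
    have "u \<cdot> (t1 \<oplus> q \<cdot> l1) = u \<cdot> t1 \<oplus> q' \<cdot> (b \<cdot> l1)"
      by simp
    also have "\<dots> \<simeq> u \<cdot> t1 \<oplus> q' \<cdot> l"
      using bl by (intro stably_add stably_refl stably_comp_left) simp_all
    also have "u \<cdot> t1 \<oplus> q' \<cdot> l = t"
      by (simp add: ql add_ac)
    finally show ?thesis
      by (intro bexI[of _ "t1 \<oplus> q \<cdot> l1"]) simp_all
  qed
qed

text \<open>The map \<open>(f, - g)\<close> into the biproduct is \<open>E\<close>-monic, because its first component is, and its cokernel
  is the pushout. So the claim is an instance of the comparison of cokernels.\<close>

lemma stable_equivalence_gluing:
  assumes po: "is_pushout C f g i j" and po': "is_pushout C f' g' i' j'"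
    and mono: "rel_monic C E f" "rel_monic C E f'"
    and a: "stable_equivalence C E a" "Dom C a = Dom C f" "Cod C a = Dom C f'"
    and b: "stable_equivalence C E b" "Dom C b = Cod C f" "Cod C b = Cod C f'"
    and c: "stable_equivalence C E c" "Dom C c = Cod C g" "Cod C c = Cod C g'"
    and squares: "b \<cdot> f = f' \<cdot> a" "c \<cdot> g = g' \<cdot> a"
    and u: "u \<in> Arr C" "Dom C u = Cod C i" "Cod C u = Cod C i'" "u \<cdot> i = i' \<cdot> b" "u \<cdot> j = j' \<cdot> c"
  shows "stable_equivalence C E u"
proof -
  note [simp] = pushoutD(1-8)[OF po] pushoutD(1-8)[OF po'] a(2,3) b(2,3) c(2,3) u(1-3)
    stable_equivalence_arr[OF a(1)] stable_equivalence_arr[OF b(1)] stable_equivalence_arr[OF c(1)]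
  obtain B i1 i2 p1 p2 where B: "biproduct C (Cod C f) (Cod C g) B i1 i2 p1 p2"
    using obtain_biproduct[OF cod_obj[OF pushoutD(1)[OF po]] cod_obj[OF pushoutD(2)[OF po]]] by blast
  then interpret B: biproduct C "Cod C f" "Cod C g" B i1 i2 p1 p2 .
  obtain B' i1' i2' p1' p2' where B': "biproduct C (Cod C f') (Cod C g') B' i1' i2' p1' p2'"
    using obtain_biproduct[OF cod_obj[OF pushoutD(1)[OF po']] cod_obj[OF pushoutD(2)[OF po']]] by blast
  then interpret B': biproduct C "Cod C f'" "Cod C g'" B' i1' i2' p1' p2' .
  have rel_monic_m: "rel_monic C E m"
    if "rel_monic C E (p \<cdot> m)" "m \<in> Arr C" "p \<in> Arr C" "Cod C m = Dom C p" for m p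
    using that retractile_E unfolding retractile_monics_def by blast
  show ?thesis
  proof (rule stable_equivalence_cokernel)
    show "rel_monic C E (i1 \<cdot> f \<oplus> \<ominus> (i2 \<cdot> g))" "rel_monic C E (i1' \<cdot> f' \<oplus> \<ominus> (i2' \<cdot> g'))"
      using rel_monic_m[of p1 "i1 \<cdot> f \<oplus> \<ominus> (i2 \<cdot> g)"] rel_monic_m[of p1' "i1' \<cdot> f' \<oplus> \<ominus> (i2' \<cdot> g')"]
        mono by simp_all
    show "stable_equivalence C E a"
      by (rule a(1))
    show "is_cokernel C (i \<cdot> p1 \<oplus> j \<cdot> p2) (i1 \<cdot> f \<oplus> \<ominus> (i2 \<cdot> g))"
      by (rule B.pushout_cokernel[OF po]) simp_all
    show "is_cokernel C (i' \<cdot> p1' \<oplus> j' \<cdot> p2') (i1' \<cdot> f' \<oplus> \<ominus> (i2' \<cdot> g'))"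
      by (rule B'.pushout_cokernel[OF po']) simp_all
    show "stable_equivalence C E (i1' \<cdot> b \<cdot> p1 \<oplus> i2' \<cdot> c \<cdot> p2)"
      by (rule stable_equivalence_biproduct[OF B B' b(1) c(1)]) simp_all
    show "(i1' \<cdot> b \<cdot> p1 \<oplus> i2' \<cdot> c \<cdot> p2) \<cdot> (i1 \<cdot> f \<oplus> \<ominus> (i2 \<cdot> g)) = (i1' \<cdot> f' \<oplus> \<ominus> (i2' \<cdot> g')) \<cdot> a"
      by (simp add: squares)
    show "(i' \<cdot> p1' \<oplus> j' \<cdot> p2') \<cdot> (i1' \<cdot> b \<cdot> p1 \<oplus> i2' \<cdot> c \<cdot> p2) = u \<cdot> (i \<cdot> p1 \<oplus> j \<cdot> p2)"
      by (simp add: comp_eq_extend[OF u(4)] comp_eq_extend[OF u(5)])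
  qed simp_all
qed


lemma stable_equivalence_cong:
  assumes "f \<simeq> g" "stable_equivalence C E g"
  shows "stable_equivalence C E f"
proof -
  note [simp] = stablyD[OF assms(1)]
  obtain h where h [simp]: "h \<in> Arr C" "Dom C h = Cod C g" "Cod C h = Dom C g"
    and gh: "g \<cdot> h \<simeq> Ident C (Cod C g)" and hg: "h \<cdot> g \<simeq> Ident C (Dom C g)"
    using stable_equivalenceE[OF assms(2)] by blast
  have "f \<cdot> h \<simeq> g \<cdot> h" "h \<cdot> f \<simeq> h \<cdot> g"
    using stably_comp_right[OF assms(1), of h] stably_comp_left[OF assms(1), of h] by simp_all
  then have "f \<cdot> h \<simeq> Ident C (Cod C g)" "h \<cdot> f \<simeq> Ident C (Dom C g)"
    using gh hg stably_trans by blast+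
  then show ?thesis
    by (intro stable_equivalence_inverseI[of f h]) simp_all
qed

text \<open>The idempotent \<open>i2 \<cdot> p2\<close> factors through \<open>Q\<close>, so \<open>i1\<close> and \<open>p1\<close> are stably inverse.\<close>

lemma stable_equivalence_projective_summand:
  assumes "biproduct C X Q B i1 i2 p1 p2" "rel_projective C E Q"
  shows "stable_equivalence C E i1" "stable_equivalence C E p1"
proof -
  interpret biproduct C X Q B i1 i2 p1 p2 by fact
  have "null E (i2 \<cdot> p2)"
    using assms(2) by (intro nullI) simp_all
  then have "i1 \<cdot> p1 \<oplus> i2 \<cdot> p2 \<simeq> i1 \<cdot> p1"
    by (intro stably_add_null) simp_all
  from stably_sym[OF this] have "i1 \<cdot> p1 \<simeq> Ident C B"
    by (simp add: biproduct_sum)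
  then show "stable_equivalence C E i1" "stable_equivalence C E p1"
    using stably_refl[of "Ident C X"]
    by (intro stable_equivalence_inverseI[of i1 p1] stable_equivalence_inverseI[of p1 i1]; simp)+
qed

end


section \<open>The Waldhausen structure\<close>

locale relative_pair = stable_class C E + injectively_detected_monics C F
  for C :: "('o, 'm, 'z) acat_scheme" (structure) and E F +
  fixes pt
  assumes zero_pt: "zero_object C pt"
    and subset: "F \<subseteq> E"
begin

abbreviation cofibrations
  where "cofibrations \<equiv> {f. rel_monic C F f}"

abbreviation weak_equivalences
  where "weak_equivalences \<equiv> {f. stable_equivalence C E f}"

lemma pt_obj [simp]: "pt \<in> Obj C"
  using zero_pt by (simp add: zero_object_def)

lemma rel_monic_F_E: "rel_monic C F f \<Longrightarrow> rel_monic C E f"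
  using subset unfolding rel_monic_def by blast

lemma waldhausen: "waldhausen_category C pt cofibrations weak_equivalences"
proof (unfold_locales, goal_cases)
  case 1 show ?case by (rule zero_pt)
next
  case (2 f g) then show ?case by (rule pushout_exists)
next
  case 3 show ?case using rel_monic_arr by auto
next
  case 4 show ?case using stable_equivalence_arr by auto
next
  case (5 f g) then show ?case using rel_monic_comp by simp
next
  case (6 f g) then show ?case using stable_equivalence_comp by simp
next
  case (7 f) then show ?case using isomorphism_rel_monic by simp
next
  case (8 X f) then show ?case using rel_monic_from_zero zero_pt by simp
next
  case (9 f g i j) then show ?case using rel_monic_pushout by simp
next
  case (10 f) then show ?case using isomorphism_stable_equivalence by simp
next
  case (11 f g i j f' g' i' j' a b c u)
  then show ?case
    using rel_monic_F_E by simp (rule stable_equivalence_gluing[of f g i j f' g' i' j' a b c u], simp_all)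
qed

end


section \<open>From a cylinder to a cone\<close>

context category
begin

lemma pushout_ident:
  assumes "f \<in> Arr C"
  shows "is_pushout C f (Ident C (Dom C f)) (Ident C (Cod C f)) f"
  unfolding is_pushout_def
proof (intro conjI ballI impI)
  fix W a b
  assume "W \<in> Obj C" "a \<in> Hom C (Cod C f) W" "b \<in> Hom C (Cod C (Ident C (Dom C f))) W"
    and ab: "a \<cdot> f = b \<cdot> Ident C (Dom C f)"
  then have [simp]: "a \<in> Arr C" "Dom C a = Cod C f" "Cod C a = W"
    and b: "b \<in> Arr C" "Dom C b = Dom C f"
    using assms by simp_all
  show "\<exists>!u. u \<in> Hom C (Cod C (Ident C (Cod C f))) W \<and> u \<cdot> Ident C (Cod C f) = a \<and> u \<cdot> f = b"
  proof (rule ex1I[of _ a])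
    show "a \<in> Hom C (Cod C (Ident C (Cod C f))) W \<and> a \<cdot> Ident C (Cod C f) = a \<and> a \<cdot> f = b"
      using assms ab b by simp
    fix u assume "u \<in> Hom C (Cod C (Ident C (Cod C f))) W \<and> u \<cdot> Ident C (Cod C f) = a \<and> u \<cdot> f = b"
    then have "u \<in> Hom C (Cod C (Ident C (Cod C f))) W" "u \<cdot> Ident C (Cod C f) = a"
      by blast+
    then show "u = a"
      using assms by simp
  qed
qed (use assms in simp_all)

lemma arrow_category_simps [simp]:
  "Obj (arrow_category C) = Arr C"
  "(f', (x, y), f) \<in> Arr (arrow_category C) \<longleftrightarrow> f' \<in> Arr C \<and> f \<in> Arr C \<and>
    x \<in> Arr C \<and> Dom C x = Dom C f' \<and> Cod C x = Dom C f \<and>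
    y \<in> Arr C \<and> Dom C y = Cod C f' \<and> Cod C y = Cod C f \<and> f \<cdot> x = y \<cdot> f'"
  "Dom (arrow_category C) (f', (x, y), f) = f'"
  "Cod (arrow_category C) (f', (x, y), f) = f"
  "Ident (arrow_category C) f = (f, (Ident C (Dom C f), Ident C (Cod C f)), f)"
  "(f1, (x', y'), f2) \<cdot>\<^bsub>arrow_category C\<^esub> (f0, (x, y), f1) = (f0, (x' \<cdot> x, y' \<cdot> y), f2)"
  by (auto simp: arrow_category_def)

end

context relative_pair
begin

lemma arr_to_pt: "f \<in> Arr C \<Longrightarrow> Cod C f = pt \<Longrightarrow> f = Zero C (Dom C f) pt"
  using zero_object_arr_eq(2)[OF zero_pt] .

text \<open>The cone on \<open>X\<close> is the cylinder of \<open>X \<rightarrow> pt\<close>, with \<open>\<eta>\<close> the front end. The back end comes from the zero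
  object and so carries no information: coproducts with it and pushouts along its identity change
  nothing, which turns the axioms for the cylinder into those for the cone.\<close>

lemma cone_if_cylinder:
  assumes "cylinder_functor C pt cofibrations weak_equivalences TO TM j1 j2 p"
    and cyl_axiom: "satisfies_cylinder_axiom C weak_equivalences p"
  shows "functorially_cone_Frobenius C E F"
proof -
  interpret cyl: cylinder_functor C pt cofibrations weak_equivalences TO TM j1 j2 p by fact
  define to_pt where "to_pt X = Zero C X pt" for X
  define sq where "sq f = (to_pt (Dom C f), (f, Ident C pt), to_pt (Cod C f))" for f
  define JO where "JO X = TO (to_pt X)" for X
  define JM where "JM f = TM (sq f)" for f
  define \<eta> where "\<eta> X = j1 (to_pt X)" for X
  have to_pt [simp]: "to_pt X \<in> Arr C" "Dom C (to_pt X) = X" "Cod C (to_pt X) = pt"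
    if "X \<in> Obj C" for X
    using that by (simp_all add: to_pt_def)
  have sq [simp]: "sq f \<in> Arr (arrow_category C)" if "f \<in> Arr C" for f
    using that by (auto simp: sq_def to_pt_def)
  have T [simp]: "TO g \<in> Obj C" "j1 g \<in> Arr C" "Dom C (j1 g) = Dom C g" "Cod C (j1 g) = TO g"
    "j2 g \<in> Arr C" "Dom C (j2 g) = Cod C g" "Cod C (j2 g) = TO g"
    "p g \<in> Arr C" "Dom C (p g) = TO g" "Cod C (p g) = Cod C g"
    if "g \<in> Arr C" for g
    using that cyl.T_functor cyl.j1_nat cyl.j2_nat cyl.p_nat
    unfolding is_functor_def is_nat_trans_def by auto
  have TM: "TM s \<in> Arr C" "Dom C (TM s) = TO (Dom (arrow_category C) s)"
    "Cod C (TM s) = TO (Cod (arrow_category C) s)"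
    if "s \<in> Arr (arrow_category C)" for s
    using that cyl.T_functor unfolding is_functor_def by auto
  have TM_nat: "j1 f \<cdot> x = TM (f', (x, y), f) \<cdot> j1 f'" "j2 f \<cdot> y = TM (f', (x, y), f) \<cdot> j2 f'"
    if "(f', (x, y), f) \<in> Arr (arrow_category C)" for f' x y f
    using bspec[OF conjunct2[OF conjunct2[OF conjunct2[OF cyl.j1_nat[unfolded is_nat_trans_def]]]] that]
      bspec[OF conjunct2[OF conjunct2[OF conjunct2[OF cyl.j2_nat[unfolded is_nat_trans_def]]]] that]
    by simp_all
  have JM [simp]: "JM f \<in> Arr C" "Dom C (JM f) = JO (Dom C f)" "Cod C (JM f) = JO (Cod C f)"
    if "f \<in> Arr C" for f
    using TM[OF sq[OF that]] by (simp_all add: JM_def JO_def sq_def)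
  have JO [simp]: "JO X \<in> Obj C" if "X \<in> Obj C" for X
    using that by (simp add: JO_def)
  have \<eta> [simp]: "\<eta> X \<in> Arr C" "Dom C (\<eta> X) = X" "Cod C (\<eta> X) = JO X" if "X \<in> Obj C" for X
    using that by (simp_all add: \<eta>_def JO_def)
  have J_functor: "is_functor C C JO JM"
    unfolding is_functor_def
  proof (intro conjI ballI impI)
    show "JM (Ident C X) = Ident C (JO X)" if "X \<in> Obj C" for X
    proof -
      have "\<forall>g \<in> Obj (arrow_category C). TM (Ident (arrow_category C) g) = Ident C (TO g)"
        using cyl.T_functor unfolding is_functor_def by blast
      from bspec[OF this, of "to_pt X"] show ?thesis
        using that by (simp add: JM_def sq_def JO_def)
    qed
    show "JM (g \<cdot> f) = JM g \<cdot> JM f" if "f \<in> Arr C" "g \<in> Arr C" "Cod C f = Dom C g" for f g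
    proof -
      have "TM (sq g \<cdot>\<^bsub>arrow_category C\<^esub> sq f) = TM (sq g) \<cdot> TM (sq f)"
      proof -
        have "Cod (arrow_category C) (sq f) = Dom (arrow_category C) (sq g)"
          using that(3) by (simp add: sq_def)
        then show ?thesis
          using cyl.T_functor sq[OF that(1)] sq[OF that(2)] unfolding is_functor_def by blast
      qed
      then show ?thesis
        using that by (simp add: JM_def sq_def)
    qed
  qed (use category_axioms in simp_all)
  have natural: "\<eta> (Cod C f) \<cdot> f = JM f \<cdot> \<eta> (Dom C f)" if "f \<in> Arr C" for f
    using TM_nat(1) sq[OF that] unfolding sq_def JM_def \<eta>_def by blast
  have "is_nat_trans C C (\<lambda>X. X) (\<lambda>f. f) JO JM \<eta>"
    unfolding is_nat_trans_def using J_functor natural category_axioms by (simp add: is_functor_def)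
  moreover have "rel_projective C E (JO X)" if "X \<in> Obj C" for X
  proof -
    \<comment> \<open>The projection from the cone to the zero object is a stable equivalence that kills the identity of
      the cone.\<close>
    have "stable_equivalence C E (p (to_pt X))"
      using cyl_axiom to_pt(1)[OF that] by (simp add: satisfies_cylinder_axiom_def)
    moreover have "p (to_pt X) \<cdot> Ident C (JO X) = Zero C (JO X) pt"
      using arr_to_pt[of "p (to_pt X)"] that by (simp add: JO_def)
    ultimately have "null E (Ident C (JO X))"
      using that null_zero[of "JO X" pt] stable_equivalence_inj[of "p (to_pt X)" "Ident C (JO X)"]
      by (simp add: JO_def)
    then show ?thesis
      using that by (intro rel_projective_if_null_ident) simp_all
  qed
  moreover have "rel_monic C F (\<eta> X)" if X: "X \<in> Obj C" for X
  proof -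
    \<comment> \<open>\<open>X\<close> itself is a coproduct of \<open>X\<close> and \<open>pt\<close>, and the map from it to the cylinder is \<open>\<eta>\<close>.\<close>
    have "is_coproduct C X pt (Ident C X) (Zero C pt X)"
      unfolding is_coproduct_def
    proof (intro conjI ballI)
      fix W a b assume "W \<in> Obj C" "a \<in> Hom C X W" "b \<in> Hom C pt W"
      then show "\<exists>!u. u \<in> Hom C (Cod C (Ident C X)) W \<and> u \<cdot> Ident C X = a \<and> u \<cdot> Zero C pt X = b"
        using X zero_object_arr_eq(1)[OF zero_pt, of b] by (intro ex1I[of _ a]) auto
    qed (use X in simp_all)
    moreover have "\<eta> X \<cdot> Zero C pt X = j2 (to_pt X)"
      using X zero_object_arr_eq(1)[OF zero_pt, of "j2 (to_pt X)"] by (simp add: JO_def)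
    ultimately show ?thesis
      using cyl.Cyl3[of "to_pt X" "Ident C X" "Zero C pt X" "\<eta> X"] X by (simp add: \<eta>_def)
  qed
  moreover have "rel_monic C F (JM f)" if "rel_monic C F f" for f
    using cyl.Cyl1_cof[OF sq[OF rel_monic_arr[OF that], unfolded sq_def]] that
      isomorphism_rel_monic[OF isomorphism_ident[OF pt_obj]]
    unfolding JM_def sq_def by blast
  moreover have "rel_monic C F u"
    if f: "rel_monic C F f" and po: "is_pushout C f (\<eta> (Dom C f)) i j"
      and u: "u \<in> Hom C (Cod C i) (JO (Cod C f))" "u \<cdot> i = \<eta> (Cod C f)" "u \<cdot> j = JM f" for f i j u
  proof -
    note [simp] = rel_monic_arr[OF f] pushoutD(3,4,6-8)[OF po]
    have [simp]: "u \<in> Arr C" "Dom C u = Cod C j" "Cod C u = JO (Cod C f)"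
      using u(1) by simp_all
    let ?j = "j \<cdot> j2 (to_pt (Dom C f))"
    have [simp]: "JO (Dom C f) = TO (to_pt (Dom C f))"
      by (simp add: JO_def)
    \<comment> \<open>The second of the two iterated pushouts is taken along the identity of \<open>pt\<close>, so the iterated pushout
      is the pushout of \<open>f\<close> and \<open>\<eta>\<close>.\<close>
    have "is_pushout C ?j (Ident C pt) (Ident C (Cod C j)) ?j"
      using pushout_ident[of ?j] by simp
    moreover have "u \<cdot> ?j = j2 (to_pt (Cod C f))"
    proof -
      have "u \<cdot> ?j = JM f \<cdot> j2 (to_pt (Dom C f))"
        by (rule comp_eq_extend1[OF u(3)]) simp_all
      also have "\<dots> = j2 (to_pt (Cod C f)) \<cdot> Ident C pt"
        using TM_nat(2)[OF sq[OF rel_monic_arr[OF f], unfolded sq_def]]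
        unfolding JM_def sq_def by (rule sym)
      finally show ?thesis
        by simp
    qed
    ultimately have "u \<in> cofibrations"
      using cyl.Cyl1_cof_pushout[of "to_pt (Dom C f)" f "Ident C pt" "to_pt (Cod C f)" i j
          "Ident C (Cod C j)" ?j u] f po u sq[of f] isomorphism_rel_monic[OF isomorphism_ident[OF pt_obj]]
      unfolding sq_def JM_def \<eta>_def by (simp add: JO_def)
    then show ?thesis
      by simp
  qed
  ultimately show ?thesis
    unfolding functorially_cone_Frobenius_def using J_functor by blast
qed

end


section \<open>From a cone to a cylinder\<close>

context abelian_category
begin

text \<open>A kernel of \<open>e\<close> is the image of the complementary idempotent \<open>1 - e\<close>.\<close>

lemma idempotent_splits:
  assumes "e \<in> Arr C" "Dom C e = X" "Cod C e = X" "e \<cdot> e = e"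
  obtains i r where "i \<in> Arr C" "r \<in> Arr C" "Cod C i = X" "Dom C r = X" "Cod C r = Dom C i"
    "r \<cdot> i = Ident C (Dom C i)" "i \<cdot> r = Ident C X \<oplus> \<ominus> e" "e \<cdot> i = Zero C (Dom C i) X"
proof -
  have [simp]: "X \<in> Obj C"
    using assms(1,2) by auto
  note [simp] = assms
  obtain i where i: "is_kernel C i e"
    using ex_kernel[OF assms(1)] by blast
  note [simp] = kernelD[OF i] comp_eq_extend1[OF kernelD(4)[OF i]]
  obtain r where [simp]: "r \<in> Arr C" "Dom C r = X" "Cod C r = Dom C i"
    and ir: "i \<cdot> r = Ident C X \<oplus> \<ominus> e"
    using kernel_factor[OF i, of "Ident C X \<oplus> \<ominus> e"] by auto
  have "i \<cdot> (r \<cdot> i) = (Ident C X \<oplus> \<ominus> e) \<cdot> i"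
    by (rule comp_eq_extend1[OF ir]) simp_all
  also have "\<dots> = i \<cdot> Ident C (Dom C i)"
    by simp
  finally have "r \<cdot> i = Ident C (Dom C i)"
    by (rule monicD[OF kernel_monic[OF i]]) simp_all
  then show ?thesis
    using that[of i r] ir by simp
qed

lemma coproduct_eqI:
  assumes "is_coproduct C X Y i1 i2" "u \<in> Arr C" "v \<in> Arr C" "Dom C u = Cod C i1"
    "Dom C v = Cod C i1" "Cod C u = Cod C v" "u \<cdot> i1 = v \<cdot> i1" "u \<cdot> i2 = v \<cdot> i2"
  shows "u = v"
proof -
  have i: "i1 \<in> Arr C" "i2 \<in> Arr C" "Dom C i1 = X" "Dom C i2 = Y" "Cod C i1 = Cod C i2"
    and uniq: "\<forall>W \<in> Obj C. \<forall>a \<in> Hom C X W. \<forall>b \<in> Hom C Y W.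
      \<exists>!u. u \<in> Hom C (Cod C i1) W \<and> u \<cdot> i1 = a \<and> u \<cdot> i2 = b"
    using assms(1) unfolding is_coproduct_def by blast+
  have "Cod C v \<in> Obj C" "v \<cdot> i1 \<in> Hom C X (Cod C v)" "v \<cdot> i2 \<in> Hom C Y (Cod C v)"
    using i assms(2-6) by simp_all
  then have "\<exists>!w. w \<in> Hom C (Cod C i1) (Cod C v) \<and> w \<cdot> i1 = v \<cdot> i1 \<and> w \<cdot> i2 = v \<cdot> i2"
    using uniq by blast
  moreover have "u \<in> Hom C (Cod C i1) (Cod C v)" "v \<in> Hom C (Cod C i1) (Cod C v)"
    using assms(2-6) by simp_all
  ultimately show ?thesis
    using assms(7,8) by blast
qed

lemma arrow_category: "category (arrow_category C)"
proof (unfold_locales, goal_cases)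
  case (1 s) then show ?case by (cases s) (auto simp: arrow_category_def)
next
  case (2 s) then show ?case by (cases s) (auto simp: arrow_category_def)
next
  case (3 f) then show ?case by (simp add: Hom_def)
next
  case (4 s f0 f1 t f2)
  then obtain x y x' y' where st: "s = (f0, (x, y), f1)" "t = (f1, (x', y'), f2)"
    by (cases s; cases t) (auto simp: Hom_def)
  with 4 have sq: "s \<in> Arr (arrow_category C)" "t \<in> Arr (arrow_category C)"
    by (simp_all add: Hom_def)
  have "f2 \<cdot> (x' \<cdot> x) = y' \<cdot> (f1 \<cdot> x)"
    by (rule comp_eq_extend) (use sq in \<open>simp_all add: st\<close>)
  then show ?case
    using sq by (simp add: st Hom_def)
next
  case (5 s f g) then show ?case by (cases s) (auto simp: Hom_def)
next
  case (6 s f g) then show ?case by (cases s) (auto simp: Hom_def)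
next
  case (7 s f g t h u k) then show ?case by (cases s; cases t; cases u) (auto simp: Hom_def)
qed

end

text \<open>The condition on the universal map is recorded in the form in which it is used: \<open>joint_extension\<close> says
  that this map is \<open>F\<close>-monic, tested by maps to \<open>F\<close>-injective objects, where a map out of the pushout is
  written as a pair \<open>a\<close>, \<open>c\<close>.\<close>

locale cone = relative_pair +
  fixes JO JM \<eta>
  assumes J_functor: "is_functor C C JO JM"
    and \<eta>_nat: "is_nat_trans C C (\<lambda>X. X) (\<lambda>f. f) JO JM \<eta>"
    and J_projective: "X \<in> Obj C \<Longrightarrow> rel_projective C E (JO X)"
    and \<eta>_monic: "X \<in> Obj C \<Longrightarrow> rel_monic C F (\<eta> X)"
    and J_monic: "rel_monic C F f \<Longrightarrow> rel_monic C F (JM f)"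
    and joint_extension: "\<lbrakk>rel_monic C F f; a \<in> Arr C; Dom C a = Cod C f; rel_injective C F (Cod C a);
      c \<in> Arr C; Dom C c = JO (Dom C f); Cod C c = Cod C a; a \<cdot> f = c \<cdot> \<eta> (Dom C f)\<rbrakk> \<Longrightarrow>
      \<exists>d \<in> Arr C. Dom C d = JO (Cod C f) \<and> d \<cdot> \<eta> (Cod C f) = a \<and> d \<cdot> JM f = c"
begin

lemma JO_obj [simp]: "X \<in> Obj C \<Longrightarrow> JO X \<in> Obj C"
  using J_functor by (simp add: is_functor_def)

lemma JM_arr [simp]:
  assumes "f \<in> Arr C"
  shows "JM f \<in> Arr C" "Dom C (JM f) = JO (Dom C f)" "Cod C (JM f) = JO (Cod C f)"
  using J_functor assms by (simp_all add: is_functor_def)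

lemma JM_ident [simp]: "X \<in> Obj C \<Longrightarrow> JM (Ident C X) = Ident C (JO X)"
  using J_functor by (simp add: is_functor_def)

lemma JM_comp: "f \<in> Arr C \<Longrightarrow> g \<in> Arr C \<Longrightarrow> Cod C f = Dom C g \<Longrightarrow> JM (g \<cdot> f) = JM g \<cdot> JM f"
  using J_functor by (simp add: is_functor_def)

lemma \<eta>_arr [simp]:
  assumes "X \<in> Obj C"
  shows "\<eta> X \<in> Arr C" "Dom C (\<eta> X) = X" "Cod C (\<eta> X) = JO X"
  using \<eta>_nat assms by (simp_all add: is_nat_trans_def)

lemma \<eta>_natural [simp]: "f \<in> Arr C \<Longrightarrow> Dom C f = X \<Longrightarrow> JM f \<cdot> \<eta> X = \<eta> (Cod C f) \<cdot> f"
  using \<eta>_nat by (auto simp: is_nat_trans_def)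

lemma joint_extensionE:
  assumes "rel_monic C F f" "a \<in> Arr C" "Dom C a = Cod C f" "rel_injective C F (Cod C a)"
    "c \<in> Arr C" "Dom C c = JO (Dom C f)" "Cod C c = Cod C a" "a \<cdot> f = c \<cdot> \<eta> (Dom C f)"
  obtains d where "d \<in> Arr C" "Dom C d = JO (Cod C f)" "Cod C d = Cod C a" "d \<cdot> \<eta> (Cod C f) = a"
    "d \<cdot> JM f = c"
proof -
  obtain d where d: "d \<in> Arr C" "Dom C d = JO (Cod C f)" "d \<cdot> \<eta> (Cod C f) = a" "d \<cdot> JM f = c"
    using joint_extension[OF assms] by blast
  then have "Cod C d = Cod C a"
    using comp_arr(3)[of "\<eta> (Cod C f)" d] rel_monic_arr[OF assms(1)] by simp
  with d show ?thesis
    using that by blast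
qed

end

locale reduced_cone = cone +
  assumes J_pt: "zero_object C (JO pt)"

lemma (in relative_pair) cone_if_functorially_cone_Frobenius:
  assumes "functorially_cone_Frobenius C E F"
  obtains JO JM \<eta> where "cone C E F pt JO JM \<eta>"
proof -
  obtain JO JM \<eta> where J: "is_functor C C JO JM" "is_nat_trans C C (\<lambda>X. X) (\<lambda>f. f) JO JM \<eta>"
    "\<forall>X \<in> Obj C. rel_projective C E (JO X)" "\<forall>X \<in> Obj C. rel_monic C F (\<eta> X)"
    and mono: "\<And>f. rel_monic C F f \<Longrightarrow> rel_monic C F (JM f)"
    and universal: "\<And>f i j u. rel_monic C F f \<Longrightarrow> is_pushout C f (\<eta> (Dom C f)) i j \<Longrightarrow>
      u \<in> Hom C (Cod C i) (JO (Cod C f)) \<Longrightarrow> u \<cdot> i = \<eta> (Cod C f) \<Longrightarrow> u \<cdot> j = JM f \<Longrightarrow> rel_monic C F u"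
    using assms unfolding functorially_cone_Frobenius_def by blast
  have [simp]: "\<eta> X \<in> Arr C" "Dom C (\<eta> X) = X" "Cod C (\<eta> X) = JO X" if "X \<in> Obj C" for X
    using J(2) that by (simp_all add: is_nat_trans_def)
  have [simp]: "JM f \<in> Arr C" "Dom C (JM f) = JO (Dom C f)" "Cod C (JM f) = JO (Cod C f)"
    if "f \<in> Arr C" for f
    using J(1) that by (simp_all add: is_functor_def)
  have "\<exists>d \<in> Arr C. Dom C d = JO (Cod C f) \<and> d \<cdot> \<eta> (Cod C f) = a \<and> d \<cdot> JM f = c"
    if f: "rel_monic C F f" and a: "a \<in> Arr C" "Dom C a = Cod C f" "rel_injective C F (Cod C a)"
      and c: "c \<in> Arr C" "Dom C c = JO (Dom C f)" "Cod C c = Cod C a" "a \<cdot> f = c \<cdot> \<eta> (Dom C f)"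
    for f a c
  proof -
    note [simp] = rel_monic_arr[OF f]
    obtain i j where po: "is_pushout C f (\<eta> (Dom C f)) i j"
      using pushout_exists[of f "\<eta> (Dom C f)"] by auto
    note [simp] = pushoutD(3,4,6-8)[OF po]
    have "\<eta> (Cod C f) \<cdot> f = JM f \<cdot> \<eta> (Dom C f)"
      using J(2) by (simp add: is_nat_trans_def)
    then obtain u where u: "u \<in> Arr C" "Dom C u = Cod C i" "Cod C u = JO (Cod C f)"
      "u \<cdot> i = \<eta> (Cod C f)" "u \<cdot> j = JM f"
      using pushout_factor[OF po, of "\<eta> (Cod C f)" "JM f"] by auto
    have "rel_monic C F u"
      by (rule universal[OF f po]) (use u in simp_all)
    moreover obtain g where g: "g \<in> Arr C" "Dom C g = Cod C i" "Cod C g = Cod C a"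
      "g \<cdot> i = a" "g \<cdot> j = c"
      using pushout_factor[OF po, of a c] a c by auto
    ultimately obtain d where d: "d \<in> Arr C" "Dom C d = Cod C u" "d \<cdot> u = g"
      using rel_injective_extend[of F g u] a(3) u(2) by auto
    have "d \<cdot> (u \<cdot> i) = g \<cdot> i" "d \<cdot> (u \<cdot> j) = g \<cdot> j"
      by (rule comp_eq_extend1[OF d(3)]; use d(1,2) u(1-3) in simp)+
    then show ?thesis
      using d(1,2) g(4,5) u(3-5) by auto
  qed
  then have "cone C E F pt JO JM \<eta>"
    using J mono by unfold_locales blast+
  then show ?thesis
    by (rule that)
qed

text \<open>The idempotents \<open>e X = J 0\<close> on \<open>J X\<close> form a natural transformation, so their kernels \<open>K X\<close> are a direct
  summand \<open>K\<close> of the functor \<open>J\<close>. The unit factors through \<open>K\<close>, because \<open>e X \<cdot> \<eta> X = \<eta> X \<cdot> 0 = 0\<close>, and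
  all properties of a cone pass to the summand. Finally \<open>e pt\<close> is the identity, since every endomorphism of
  \<open>pt\<close> is, and so \<open>K pt = 0\<close>.\<close>

lemma (in cone) reduced_cone_exists:
  obtains JO' JM' \<eta>' where "reduced_cone C E F pt JO' JM' \<eta>'"
proof -
  define e where "e X = JM (Zero C X X)" for X
  have e [simp]: "e X \<in> Arr C" "Dom C (e X) = JO X" "Cod C (e X) = JO X" if "X \<in> Obj C" for X
    using that by (simp_all add: e_def)
  have "\<exists>i r. i \<in> Arr C \<and> r \<in> Arr C \<and> Cod C i = JO X \<and> Dom C r = JO X \<and> Cod C r = Dom C i \<and>
    r \<cdot> i = Ident C (Dom C i) \<and> i \<cdot> r = Ident C (JO X) \<oplus> \<ominus> (e X) \<and> e X \<cdot> i = Zero C (Dom C i) (JO X)"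
    if "X \<in> Obj C" for X
  proof -
    have "e X \<cdot> e X = e X"
      using that JM_comp[of "Zero C X X" "Zero C X X"] by (simp add: e_def)
    then show ?thesis
      using idempotent_splits[of "e X" "JO X"] e[OF that] by metis
  qed
  then obtain \<iota> \<rho> where split: "\<forall>X \<in> Obj C. \<iota> X \<in> Arr C \<and> \<rho> X \<in> Arr C \<and> Cod C (\<iota> X) = JO X \<and>
    Dom C (\<rho> X) = JO X \<and> Cod C (\<rho> X) = Dom C (\<iota> X) \<and> \<rho> X \<cdot> \<iota> X = Ident C (Dom C (\<iota> X)) \<and>
    \<iota> X \<cdot> \<rho> X = Ident C (JO X) \<oplus> \<ominus> (e X) \<and> e X \<cdot> \<iota> X = Zero C (Dom C (\<iota> X)) (JO X)"
    by metis
  define K where "K X = Dom C (\<iota> X)" for X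
  have \<iota> [simp]: "\<iota> X \<in> Arr C" "Dom C (\<iota> X) = K X" "Cod C (\<iota> X) = JO X" if "X \<in> Obj C" for X
    using split that unfolding K_def by blast+
  have K [simp]: "K X \<in> Obj C" if "X \<in> Obj C" for X
    using \<iota>[OF that] by (metis dom_obj)
  have \<rho> [simp]: "\<rho> X \<in> Arr C" "Dom C (\<rho> X) = JO X" "Cod C (\<rho> X) = K X" if "X \<in> Obj C" for X
    using split that unfolding K_def by blast+
  have \<rho>\<iota> [simp]: "\<rho> X \<cdot> \<iota> X = Ident C (K X)" if "X \<in> Obj C" for X
    using split that unfolding K_def by blast
  have \<iota>\<rho>: "\<iota> X \<cdot> \<rho> X = Ident C (JO X) \<oplus> \<ominus> (e X)" if "X \<in> Obj C" for X
    using split that by simp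
  have e\<iota>: "e X \<cdot> \<iota> X = Zero C (K X) (JO X)" if "X \<in> Obj C" for X
    using split that unfolding K_def by blast
  have \<iota>\<rho>_fix: "\<iota> X \<cdot> (\<rho> X \<cdot> h) = h"
    if "X \<in> Obj C" "h \<in> Arr C" "Cod C h = JO X" "e X \<cdot> h = Zero C (Dom C h) (JO X)" for X h
  proof -
    have "\<iota> X \<cdot> (\<rho> X \<cdot> h) = (Ident C (JO X) \<oplus> \<ominus> (e X)) \<cdot> h"
      by (rule comp_eq_extend1[OF \<iota>\<rho>]) (use that in simp_all)
    then show ?thesis
      using that by simp
  qed
  have e_natural: "e (Cod C f) \<cdot> (JM f \<cdot> \<iota> (Dom C f)) = Zero C (K (Dom C f)) (JO (Cod C f))"
    if "f \<in> Arr C" for f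
  proof -
    have "e (Cod C f) \<cdot> JM f = JM f \<cdot> e (Dom C f)"
      using that JM_comp[of f "Zero C (Cod C f) (Cod C f)"] JM_comp[of "Zero C (Dom C f) (Dom C f)" f]
      by (simp add: e_def)
    then have "e (Cod C f) \<cdot> (JM f \<cdot> \<iota> (Dom C f)) = JM f \<cdot> (e (Dom C f) \<cdot> \<iota> (Dom C f))"
      by (rule comp_eq_extend) (use that in simp_all)
    then show ?thesis
      using that by (simp add: e\<iota>)
  qed
  define KM where "KM f = \<rho> (Cod C f) \<cdot> (JM f \<cdot> \<iota> (Dom C f))" for f
  define \<theta> where "\<theta> X = \<rho> X \<cdot> \<eta> X" for X
  have KM [simp]: "KM f \<in> Arr C" "Dom C (KM f) = K (Dom C f)" "Cod C (KM f) = K (Cod C f)"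
    if "f \<in> Arr C" for f
    using that by (simp_all add: KM_def)
  have \<theta> [simp]: "\<theta> X \<in> Arr C" "Dom C (\<theta> X) = X" "Cod C (\<theta> X) = K X" if "X \<in> Obj C" for X
    using that by (simp_all add: \<theta>_def)
  have \<iota>KM: "\<iota> (Cod C f) \<cdot> KM f = JM f \<cdot> \<iota> (Dom C f)" if "f \<in> Arr C" for f
    unfolding KM_def by (rule \<iota>\<rho>_fix) (use that e_natural in simp_all)
  have \<iota>\<theta>: "\<iota> X \<cdot> \<theta> X = \<eta> X" if "X \<in> Obj C" for X
    unfolding \<theta>_def by (rule \<iota>\<rho>_fix) (use that in \<open>simp_all add: e_def\<close>)
  have \<iota>_cancel: "g = h"
    if "\<iota> X \<cdot> g = \<iota> X \<cdot> h" "X \<in> Obj C" "g \<in> Arr C" "h \<in> Arr C" "Dom C g = Dom C h"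
      "Cod C g = K X" "Cod C h = K X" for X g h
  proof -
    have "\<rho> X \<cdot> (\<iota> X \<cdot> g) = g" "\<rho> X \<cdot> (\<iota> X \<cdot> h) = h"
      by (rule comp_ident_cancel[OF \<rho>\<iota>]; use that(2-7) in simp)+
    with that(1) show ?thesis
      by metis
  qed
  have K_functor: "is_functor C C K KM"
    unfolding is_functor_def
  proof (intro conjI ballI impI)
    show "KM (Ident C X) = Ident C (K X)" if "X \<in> Obj C" for X
      using that by (simp add: KM_def)
    show "KM (g \<cdot> f) = KM g \<cdot> KM f" if [simp]: "f \<in> Arr C" "g \<in> Arr C" "Cod C f = Dom C g" for f g
    proof (rule \<iota>_cancel)
      have "\<iota> (Cod C g) \<cdot> KM (g \<cdot> f) = JM g \<cdot> (JM f \<cdot> \<iota> (Dom C f))"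
        using \<iota>KM[of "g \<cdot> f"] by (simp add: JM_comp)
      also have "\<dots> = JM g \<cdot> (\<iota> (Dom C g) \<cdot> KM f)"
        using \<iota>KM[of f] by simp
      also have "\<dots> = \<iota> (Cod C g) \<cdot> (KM g \<cdot> KM f)"
        by (rule comp_eq_extend[OF \<iota>KM[symmetric]]) simp_all
      finally show "\<iota> (Cod C g) \<cdot> KM (g \<cdot> f) = \<iota> (Cod C g) \<cdot> (KM g \<cdot> KM f)" .
    qed simp_all
  qed (use category_axioms in simp_all)
  have \<theta>_natural: "\<theta> (Cod C f) \<cdot> f = KM f \<cdot> \<theta> (Dom C f)" if [simp]: "f \<in> Arr C" for f
  proof (rule \<iota>_cancel)
    have "\<iota> (Cod C f) \<cdot> (KM f \<cdot> \<theta> (Dom C f)) = JM f \<cdot> (\<iota> (Dom C f) \<cdot> \<theta> (Dom C f))"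
      by (rule comp_eq_extend[OF \<iota>KM]) simp_all
    also have "\<dots> = \<eta> (Cod C f) \<cdot> f"
      by (simp add: \<iota>\<theta>)
    also have "\<dots> = \<iota> (Cod C f) \<cdot> (\<theta> (Cod C f) \<cdot> f)"
      by (rule comp_eq_extend1[OF \<iota>\<theta>, symmetric]) simp_all
    finally show "\<iota> (Cod C f) \<cdot> (\<theta> (Cod C f) \<cdot> f) = \<iota> (Cod C f) \<cdot> (KM f \<cdot> \<theta> (Dom C f))"
      by simp
  qed simp_all
  have \<iota>_monic: "rel_monic C F (\<iota> X)" if "X \<in> Obj C" for X
    by (rule left_inverse_rel_monic[of "\<rho> X"]) (use that in simp_all)
  have "reduced_cone C E F pt K KM \<theta>"
  proof (unfold_locales, goal_cases)
    case 1 show ?case by (rule K_functor)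
  next
    case 2 show ?case
      unfolding is_nat_trans_def using K_functor \<theta>_natural category_axioms
      by (simp add: is_functor_def)
  next
    case (3 X)
    have "null E (\<rho> X \<cdot> \<iota> X)"
      using 3 J_projective by (intro nullI) simp_all
    then show ?case
      using 3 rel_projective_if_null_ident by simp
  next
    case (4 X)
    then show ?case
      using \<eta>_monic[OF 4] \<iota>\<theta>[OF 4] rel_monic_right_factor[of "\<iota> X" "\<theta> X"] by simp
  next
    case (5 f)
    note [simp] = rel_monic_arr[OF 5]
    have "rel_monic C F (JM f \<cdot> \<iota> (Dom C f))"
      using J_monic[OF 5] \<iota>_monic by (intro rel_monic_comp) simp_all
    then show ?case
      using \<iota>KM[of f] rel_monic_right_factor[of "\<iota> (Cod C f)" "KM f"] by simp
  next
    case (6 f a c)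
    note [simp] = rel_monic_arr[OF 6(1)] 6(2,3,5-7)
    obtain d where [simp]: "d \<in> Arr C" "Dom C d = JO (Cod C f)" "Cod C d = Cod C a"
      and d: "d \<cdot> \<eta> (Cod C f) = a" "d \<cdot> JM f = c \<cdot> \<rho> (Dom C f)"
      using joint_extensionE[OF 6(1-4), of "c \<cdot> \<rho> (Dom C f)"] 6(8) by (auto simp: \<theta>_def)
    have "d \<cdot> (JM f \<cdot> \<iota> (Dom C f)) = (c \<cdot> \<rho> (Dom C f)) \<cdot> \<iota> (Dom C f)"
      by (rule comp_eq_extend1[OF d(2)]) simp_all
    then have "(d \<cdot> \<iota> (Cod C f)) \<cdot> \<theta> (Cod C f) = a" "(d \<cdot> \<iota> (Cod C f)) \<cdot> KM f = c"
      by (simp_all add: \<iota>\<theta> \<iota>KM d(1))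
    then show ?case
      by (intro bexI[of _ "d \<cdot> \<iota> (Cod C f)"]) simp_all
  next
    case 7
    have "e pt = Ident C (JO pt)"
      by (simp add: e_def ident_zero_object[OF zero_pt, symmetric])
    then have "\<iota> pt = Zero C (K pt) (JO pt)"
      using e\<iota>[of pt] by simp
    then have "Ident C (K pt) = Zero C (K pt) (K pt)"
      using \<rho>\<iota>[of pt] by simp
    then show ?case
      by (intro zero_objectI) simp_all
  qed
  then show ?thesis
    by (rule that)
qed


text \<open>The biproducts may be chosen for each arrow separately, without any coherence: the maps between cylinders
  are given by matrices, and these compose correctly for every choice. Only for arrows from \<open>pt\<close> the choice
  matters, where the cylinder has to be the codomain on the nose.\<close>

locale mapping_cylinder = reduced_cone +
  fixes P i1 i2 p1 p2
  assumes summands: "f \<in> Arr C \<Longrightarrow>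
      biproduct C (Cod C f) (JO (Dom C f)) (P f) (i1 f) (i2 f) (p1 f) (p2 f)"
    and summands_pt: "f \<in> Arr C \<Longrightarrow> Dom C f = pt \<Longrightarrow>
      P f = Cod C f \<and> i1 f = Ident C (Cod C f) \<and> p1 f = Ident C (Cod C f)"
begin

lemmas summands_simps [simp] =
  biproduct.biproduct_arr[OF summands] biproduct.biproduct_ident[OF summands]
  biproduct.biproduct_zero[OF summands] biproduct.biproduct_comp[OF summands]

definition T
  where "T = (\<lambda>(f', (x, y), f). i1 f \<cdot> (y \<cdot> p1 f') \<oplus> i2 f \<cdot> (JM x \<cdot> p2 f'))"

definition j1
  where "j1 f = i1 f \<cdot> f \<oplus> i2 f \<cdot> \<eta> (Dom C f)"

lemma j1_arr [simp]:
  assumes "f \<in> Arr C"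
  shows "j1 f \<in> Arr C" "Dom C (j1 f) = Dom C f" "Cod C (j1 f) = P f"
  using assms by (simp_all add: j1_def)

lemma T_arr [simp]:
  assumes "(f', (x, y), f) \<in> Arr (arrow_category C)"
  shows "T (f', (x, y), f) \<in> Arr C" "Dom C (T (f', (x, y), f)) = P f'"
    "Cod C (T (f', (x, y), f)) = P f"
  using assms by (simp_all add: T_def)

lemma T_functor: "is_functor (arrow_category C) C P T"
  unfolding is_functor_def
proof (intro conjI ballI impI)
  show "T s \<in> Hom C (P (Dom (arrow_category C) s)) (P (Cod (arrow_category C) s))"
    if s: "s \<in> Arr (arrow_category C)" for s
  proof -
    obtain f' x y f where "s = (f', (x, y), f)"
      by (metis surj_pair)
    with s show ?thesis
      by (simp add: T_def)
  qed
  show "T (Ident (arrow_category C) f) = Ident C (P f)" if "f \<in> Obj (arrow_category C)" for f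
    using that biproduct.biproduct_sum[OF summands, of f] by (simp add: T_def)
  show "T (t \<cdot>\<^bsub>arrow_category C\<^esub> s) = T t \<cdot> T s"
    if st: "s \<in> Arr (arrow_category C)" "t \<in> Arr (arrow_category C)"
      "Cod (arrow_category C) s = Dom (arrow_category C) t" for s t
  proof -
    obtain f0 x y f1 where s: "s = (f0, (x, y), f1)"
      by (metis surj_pair)
    obtain x' y' f2 where t: "t = (f1, (x', y'), f2)"
      using st(3) by (cases t) (auto simp: s)
    show ?thesis
      using st(1,2) by (simp add: s t T_def JM_comp)
  qed
qed (use arrow_category category_axioms in simp_all)

lemma dom_functor: "is_functor (arrow_category C) C (Dom C) (\<lambda>(f', (x, y), f). x)"
  unfolding is_functor_def using arrow_category category_axioms by auto

lemma cod_functor: "is_functor (arrow_category C) C (Cod C) (\<lambda>(f', (x, y), f). y)"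
  unfolding is_functor_def using arrow_category category_axioms by auto

lemma natural_transformations:
  "is_nat_trans (arrow_category C) C (Dom C) (\<lambda>(f', (x, y), f). x) P T j1"
  "is_nat_trans (arrow_category C) C (Cod C) (\<lambda>(f', (x, y), f). y) P T i1"
  "is_nat_trans (arrow_category C) C P T (Cod C) (\<lambda>(f', (x, y), f). y) p1"
  unfolding is_nat_trans_def
  using T_functor dom_functor cod_functor by (auto simp: T_def j1_def)

text \<open>Modulo maps that factor through a cone, \<open>T\<close> is \<open>i1 \<cdot> y \<cdot> p1\<close>, a composite of stable
  equivalences.\<close>

lemma T_weak_equivalence:
  assumes sq: "(f', (x, y), f) \<in> Arr (arrow_category C)" and y: "stable_equivalence C E y"
  shows "stable_equivalence C E (T (f', (x, y), f))"
proof (rule stable_equivalence_cong)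
  have [simp]: "f' \<in> Arr C" "f \<in> Arr C" "x \<in> Arr C" "Dom C x = Dom C f'" "Cod C x = Dom C f"
    "y \<in> Arr C" "Dom C y = Cod C f'" "Cod C y = Cod C f"
    using sq by simp_all
  have "null E (i2 f \<cdot> (JM x \<cdot> p2 f'))"
    using J_projective by (intro nullI) simp_all
  then show "T (f', (x, y), f) \<simeq> i1 f \<cdot> (y \<cdot> p1 f')"
    unfolding T_def prod.case by (intro stably_add_null) simp_all
  show "stable_equivalence C E (i1 f \<cdot> (y \<cdot> p1 f'))"
    using stable_equivalence_projective_summand[OF summands J_projective] y
    by (intro stable_equivalence_comp) simp_all
qed

lemma T_cofibration:
  assumes sq: "(f', (x, y), f) \<in> Arr (arrow_category C)"
    and xy: "rel_monic C F x" "rel_monic C F y"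
  shows "rel_monic C F (T (f', (x, y), f))"
proof (rule rel_monicI)
  note [simp] = T_arr[OF sq]
  have [simp]: "f' \<in> Arr C" "f \<in> Arr C" "x \<in> Arr C" "Dom C x = Dom C f'" "Cod C x = Dom C f"
    "y \<in> Arr C" "Dom C y = Cod C f'" "Cod C y = Cod C f"
    using sq by simp_all
  show "T (f', (x, y), f) \<in> Arr C"
    by simp
  fix a assume "a \<in> Arr C" "Dom C a = Dom C (T (f', (x, y), f))" and inj: "rel_injective C F (Cod C a)"
  then have [simp]: "a \<in> Arr C" "Dom C a = P f'"
    by simp_all
  obtain b where [simp]: "b \<in> Arr C" "Dom C b = Cod C f" "Cod C b = Cod C a" "b \<cdot> y = a \<cdot> i1 f'"
    using rel_injective_extend[of F "a \<cdot> i1 f'" y] inj xy(2) by auto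
  obtain d where [simp]: "d \<in> Arr C" "Dom C d = JO (Dom C f)" "Cod C d = Cod C a"
    "d \<cdot> JM x = a \<cdot> i2 f'"
    using rel_injective_extend[of F "a \<cdot> i2 f'" "JM x"] inj J_monic[OF xy(1)] by auto
  have "(b \<cdot> p1 f \<oplus> d \<cdot> p2 f) \<cdot> T (f', (x, y), f) = a"
    by (rule biproduct.out_eqI[OF summands, of f']) (simp_all add: T_def)
  then show "\<exists>b \<in> Arr C. Dom C b = Cod C (T (f', (x, y), f)) \<and> b \<cdot> T (f', (x, y), f) = a"
    by (intro bexI[of _ "b \<cdot> p1 f \<oplus> d \<cdot> p2 f"]) simp_all
qed

text \<open>A map \<open>g\<close> from the iterated pushout amounts to maps \<open>a\<close> on \<open>X\<close>, \<open>b\<close> on \<open>Y\<close> and \<open>c\<close> on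
  \<open>Y' \<oplus> J X'\<close>, and only the second component of \<open>c\<close> is independent of \<open>b\<close>. An extension to
  \<open>Y \<oplus> J X\<close> has to be \<open>b\<close> on \<open>Y\<close>. Its restriction to \<open>X\<close> along the front end \<open>(f, \<eta>)\<close> is \<open>a\<close> if and
  only if on \<open>J X\<close> it is an extension of \<open>a - b \<cdot> f\<close> along \<open>\<eta>\<close>; so after this shear only a joint
  extension to \<open>J X\<close> remains to be found.\<close>

lemma T_pushout_cofibration:
  assumes sq: "(f', (x, y), f) \<in> Arr (arrow_category C)" and x: "rel_monic C F x"
    and po: "is_pushout C x (j1 f') i i'" and po': "is_pushout C (i' \<cdot> i1 f') y k k'"
    and u: "u \<in> Arr C" "Dom C u = Cod C k" "Cod C u = P f" "u \<cdot> (k \<cdot> i) = j1 f"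
      "u \<cdot> (k \<cdot> i') = T (f', (x, y), f)" "u \<cdot> k' = i1 f"
  shows "rel_monic C F u"
proof (rule rel_monicI)
  note [simp] = T_arr[OF sq] u(1-3)
  have [simp]: "f' \<in> Arr C" "f \<in> Arr C" "x \<in> Arr C" "Dom C x = Dom C f'" "Cod C x = Dom C f"
    "y \<in> Arr C" "Dom C y = Cod C f'" "Cod C y = Cod C f" and fx: "f \<cdot> x = y \<cdot> f'"
    using sq by simp_all
  have [simp]: "i \<in> Arr C" "i' \<in> Arr C" "Dom C i = Dom C f" "Dom C i' = P f'" "Cod C i = Cod C i'"
    using pushoutD[OF po] by simp_all
  have [simp]: "k \<in> Arr C" "k' \<in> Arr C" "Dom C k = Cod C i'" "Dom C k' = Cod C f" "Cod C k = Cod C k'"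
    using pushoutD[OF po'] by simp_all
  show "u \<in> Arr C"
    by simp
  fix g assume "g \<in> Arr C" "Dom C g = Dom C u" and inj: "rel_injective C F (Cod C g)"
  then have [simp]: "g \<in> Arr C" "Dom C g = Cod C k'"
    by simp_all
  let ?a = "g \<cdot> (k \<cdot> i)" and ?b = "g \<cdot> k'" and ?c = "g \<cdot> (k \<cdot> i')"
  have bi: "?c \<cdot> i1 f' = ?b \<cdot> y"
    using pushoutD(9)[OF po'] by simp
  have "?a \<cdot> x = ?c \<cdot> j1 f'"
    using pushoutD(9)[OF po] by simp
  also have "\<dots> = (?c \<cdot> i1 f') \<cdot> f' \<oplus> (?c \<cdot> i2 f') \<cdot> \<eta> (Dom C f')"
    by (simp add: j1_def)
  also have "\<dots> = (?b \<cdot> y) \<cdot> f' \<oplus> (?c \<cdot> i2 f') \<cdot> \<eta> (Dom C f')"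
    by (simp only: bi)
  finally have "(?a \<oplus> \<ominus> (?b \<cdot> f)) \<cdot> x = (?c \<cdot> i2 f') \<cdot> \<eta> (Dom C x)"
    by (simp add: fx add_ac)
  then obtain d where [simp]: "d \<in> Arr C" "Dom C d = JO (Dom C f)" "Cod C d = Cod C g"
    and d: "d \<cdot> \<eta> (Dom C f) = ?a \<oplus> \<ominus> (?b \<cdot> f)" "d \<cdot> JM x = ?c \<cdot> i2 f'"
    using joint_extensionE[OF x, of "?a \<oplus> \<ominus> (?b \<cdot> f)" "?c \<cdot> i2 f'"] inj by auto
  let ?h = "?b \<cdot> p1 f \<oplus> d \<cdot> p2 f"
  have "?h \<cdot> u = g"
  proof (rule pushout_eqI[OF po'])
    show "(?h \<cdot> u) \<cdot> k' = g \<cdot> k'"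
      using u(6) by simp
    show "(?h \<cdot> u) \<cdot> k = g \<cdot> k"
    proof (rule pushout_eqI[OF po])
      show "((?h \<cdot> u) \<cdot> k) \<cdot> i = (g \<cdot> k) \<cdot> i"
        using u(4) d(1) by (simp add: j1_def add_ac)
      show "((?h \<cdot> u) \<cdot> k) \<cdot> i' = (g \<cdot> k) \<cdot> i'"
      proof (rule biproduct.out_eqI[OF summands, of f'])
        have hu: "((?h \<cdot> u) \<cdot> k) \<cdot> i' = ?h \<cdot> T (f', (x, y), f)"
          using u(5) by simp
        show "(((?h \<cdot> u) \<cdot> k) \<cdot> i') \<cdot> i1 f' = ((g \<cdot> k) \<cdot> i') \<cdot> i1 f'"
          unfolding hu using bi by (simp add: T_def)
        show "(((?h \<cdot> u) \<cdot> k) \<cdot> i') \<cdot> i2 f' = ((g \<cdot> k) \<cdot> i') \<cdot> i2 f'"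
          unfolding hu using d(2) by (simp add: T_def)
      qed simp_all
    qed simp_all
  qed simp_all
  then show "\<exists>b \<in> Arr C. Dom C b = Cod C u \<and> b \<cdot> u = g"
    by (intro bexI[of _ ?h]) simp_all
qed

text \<open>The same shear as before: given \<open>a\<close> on \<open>X\<close> and \<open>b\<close> on \<open>Y\<close>, extend by \<open>b\<close> on \<open>Y\<close> and by an extension
  of \<open>a - b \<cdot> f\<close> along \<open>\<eta>\<close> on \<open>J X\<close>.\<close>

lemma ends_cofibration:
  assumes f: "f \<in> Arr C" and cop: "is_coproduct C (Dom C f) (Cod C f) k1 k2"
    and u: "u \<in> Arr C" "Dom C u = Cod C k1" "Cod C u = P f" "u \<cdot> k1 = j1 f" "u \<cdot> k2 = i1 f"
  shows "rel_monic C F u"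
proof (rule rel_monicI)
  note [simp] = f u(1-3)
  have [simp]: "k1 \<in> Arr C" "k2 \<in> Arr C" "Dom C k1 = Dom C f" "Dom C k2 = Cod C f" "Cod C k1 = Cod C k2"
    using cop unfolding is_coproduct_def by blast+
  show "u \<in> Arr C"
    by simp
  fix g assume "g \<in> Arr C" "Dom C g = Dom C u" and inj: "rel_injective C F (Cod C g)"
  then have [simp]: "g \<in> Arr C" "Dom C g = Cod C k2"
    by simp_all
  obtain d where [simp]: "d \<in> Arr C" "Dom C d = JO (Dom C f)" "Cod C d = Cod C g"
    and d: "d \<cdot> \<eta> (Dom C f) = g \<cdot> k1 \<oplus> \<ominus> (g \<cdot> (k2 \<cdot> f))"
    using rel_injective_extend[of F "g \<cdot> k1 \<oplus> \<ominus> (g \<cdot> (k2 \<cdot> f))" "\<eta> (Dom C f)"] inj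
      \<eta>_monic[of "Dom C f"] by auto
  let ?h = "(g \<cdot> k2) \<cdot> p1 f \<oplus> d \<cdot> p2 f"
  have "?h \<cdot> u = g"
  proof (rule coproduct_eqI[OF cop])
    show "(?h \<cdot> u) \<cdot> k1 = g \<cdot> k1"
      using u(4) d by (simp add: j1_def add_ac)
    show "(?h \<cdot> u) \<cdot> k2 = g \<cdot> k2"
      using u(5) by simp
  qed simp_all
  then show "\<exists>b \<in> Arr C. Dom C b = Cod C u \<and> b \<cdot> u = g"
    by (intro bexI[of _ ?h]) simp_all
qed

lemma cylinder: "cylinder_functor C pt cofibrations weak_equivalences P T j1 i1 p1"
proof -
  interpret W: waldhausen_category C pt cofibrations weak_equivalences
    by (rule waldhausen)
  show ?thesis
  proof (unfold_locales, goal_cases)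
    case 1 show ?case by (rule T_functor)
  next
    case 2 show ?case by (rule natural_transformations)
  next
    case 3 show ?case by (rule natural_transformations)
  next
    case 4 show ?case by (rule natural_transformations)
  next
    case (5 f) then show ?case by (simp add: j1_def)
  next
    case (6 f) then show ?case by simp
  next
    case (7 f' x y f) then show ?case using T_weak_equivalence by blast
  next
    case (8 f' x y f) then show ?case using T_cofibration by blast
  next
    case (9 f' x y f i i' k k' u)
    then show ?case
      using T_pushout_cofibration[of f' x y f i i' k k' u] by simp
  next
    case (10 Y f) then show ?case using summands_pt[of f] by simp
  next
    case (11 f k1 k2 u)
    then show ?case using ends_cofibration[of f k1 k2 u] by simp
  qed
qed

lemma cylinder_axiom: "satisfies_cylinder_axiom C weak_equivalences p1"
  unfolding satisfies_cylinder_axiom_def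
  using stable_equivalence_projective_summand(2)[OF summands J_projective] by simp

end

text \<open>Since \<open>J pt\<close> is a zero object, \<open>Y\<close> with its identity is a biproduct of \<open>Y\<close> and \<open>J pt\<close>.\<close>

lemma (in reduced_cone) mapping_cylinder_exists:
  obtains P i1 i2 p1 p2 where "mapping_cylinder C E F pt JO JM \<eta> P i1 i2 p1 p2"
proof -
  have "\<exists>B k1 k2 q1 q2. biproduct C (Cod C f) (JO (Dom C f)) B k1 k2 q1 q2 \<and>
      (Dom C f = pt \<longrightarrow> B = Cod C f \<and> k1 = Ident C (Cod C f) \<and> q1 = Ident C (Cod C f))"
    if [simp]: "f \<in> Arr C" for f
  proof (cases "Dom C f = pt")
    case True
    let ?Y = "Cod C f"
    have "is_biproduct C ?Y (JO pt) ?Y (Ident C ?Y) (Zero C (JO pt) ?Y) (Ident C ?Y) (Zero C ?Y (JO pt))"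
      by (simp add: is_biproduct_def ident_zero_object[OF J_pt])
    then have "biproduct C ?Y (JO pt) ?Y (Ident C ?Y) (Zero C (JO pt) ?Y) (Ident C ?Y) (Zero C ?Y (JO pt))"
      by unfold_locales
    with True show ?thesis
      by metis
  next
    case False
    then show ?thesis
      using obtain_biproduct[of "Cod C f" "JO (Dom C f)"] that by (metis cod_obj dom_obj JO_obj)
  qed
  then obtain P i1 i2 p1 p2 where
    "\<forall>f \<in> Arr C. biproduct C (Cod C f) (JO (Dom C f)) (P f) (i1 f) (i2 f) (p1 f) (p2 f) \<and>
      (Dom C f = pt \<longrightarrow> P f = Cod C f \<and> i1 f = Ident C (Cod C f) \<and> p1 f = Ident C (Cod C f))"
    by metis
  then have "mapping_cylinder C E F pt JO JM \<eta> P i1 i2 p1 p2"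
    by unfold_locales (blast intro: biproduct.biproduct)+
  then show ?thesis
    by (rule that)
qed


section \<open>The equivalence\<close>

theorem theorem3p11:
  fixes C :: "('o, 'm, 'z) acat_scheme"
    and pt :: 'o
    and E F :: "('m \<times> 'm) set"
  assumes "abelian_category C"
    and "zero_object C pt"
    and "allowable_class C E"
    and "allowable_class C F"
    and "F \<subseteq> E"
    and "retractile_monics C F"
    and "retractile_monics C E"
    and "sectile_epics C E"
    and "enough_injectives C F"
    and "enough_projectives C E"
    and "enough_injectives C E"
    and "\<forall>X. rel_projective C E X \<longrightarrow> rel_injective C E X"
  shows "(\<exists>TO TM j1 j2 p.
      cylinder_functor C pt {f. rel_monic C F f} {f. stable_equivalence C E f} TO TM j1 j2 p \<and>
      satisfies_cylinder_axiom C {f. stable_equivalence C E f} p)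
    \<longleftrightarrow> functorially_cone_Frobenius C E F"
proof -
  interpret abelian_category C by fact
  interpret relative_pair C E F pt
    using assms by unfold_locales blast+
  show ?thesis
  proof
    assume "\<exists>TO TM j1 j2 p. cylinder_functor C pt cofibrations weak_equivalences TO TM j1 j2 p \<and>
      satisfies_cylinder_axiom C weak_equivalences p"
    then show "functorially_cone_Frobenius C E F"
      using cone_if_cylinder by blast
  next
    assume "functorially_cone_Frobenius C E F"
    then obtain JO JM \<eta> where "cone C E F pt JO JM \<eta>"
      by (rule cone_if_functorially_cone_Frobenius)
    then obtain KO KM \<theta> where "reduced_cone C E F pt KO KM \<theta>"
      by (rule cone.reduced_cone_exists)
    then obtain P i1 i2 p1 p2 where "mapping_cylinder C E F pt KO KM \<theta> P i1 i2 p1 p2"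
      by (rule reduced_cone.mapping_cylinder_exists)
    then interpret mapping_cylinder C E F pt KO KM \<theta> P i1 i2 p1 p2 .
    show "\<exists>TO TM j1 j2 p. cylinder_functor C pt cofibrations weak_equivalences TO TM j1 j2 p \<and>
      satisfies_cylinder_axiom C weak_equivalences p"
      using cylinder cylinder_axiom by blast
  qed
qed

end
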